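(* Let $\mathbb{L}$ be a projective line groupoid with at least five points, with group of abstract scalars $G$ and scalar field $k = G\cup\{0\}$. Then $\mathbb{L}$ is isomorphic, as a groupoid with projection structure, to the groupoid $\mathbb{L}(k^{2})$.
   Context: Groupoids: $|\mathbb{L}|$ is the set of objects (also called points) of a groupoid $\mathbb{L}$; composition is written left to right, $f.g$ meaning first $f$, then $g$. A projection structure on $\mathbb{L}$ consists of, for any two distinct objects $A,B$, a bijection between $\hom_{\mathbb{L}}(A,B)$ and $|\mathbb{L}|\setminus\{A,B\}$; the arrow $A\to B$ corresponding to $C$ (with $C\neq A,B$) is denoted $C:A\to B$. A morphism $P:\mathbb{L}\to\mathbb{L}'$ of groupoids with projection structure is a functor, injective on objects, with $P(C:A\to B) = (P(C):P(A)\to P(B))$ for all distinct $A,B,C$; an isomorphism is an invertible such morphism. Standing assumptions: $\mathbb{L}$ has at least three objects (hence is connected) and is commutative, i.e. the vertex groups $\hom_{\mathbb{L}}(A,A)$ are commutative. Then for any arrow $\alpha:A\to B$ the isomorphism $\hom_{\mathbb{L}}(A,A)\to\hom_{\mathbb{L}}(B,B)$, $\mu\mapsto\alpha^{-1}.\mu.\alpha$, does not depend on $\alpha$, and via these canonical isomorphisms all vertex groups are identified with a single commutative group $G$, the group of abstract scalars. One writes $\mu\equiv\mu'$ for $\mu\in\hom_{\mathbb{L}}(A,A)$, $\mu'\in\hom_{\mathbb{L}}(B,B)$ if they represent the same element of $G$. Cross ratio: for four distinct points, $(A,B;C,D)$ is the scalar $(C:A\to B).(D:B\to A)\in\hom_{\mathbb{L}}(A,A)$,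 or the element of $G$ it represents. Tri-rapport: for distinct $A,B,C$ and $X\ne A,B$, $Y\neq B,C$, $Z\neq C,A$, $(A,B,C;X,Y,Z)$ is the scalar $(X:A\to B).(Y:B\to C).(Z:C\to A)\in\hom_{\mathbb{L}}(A,A)$. Axiom 1: for mutually distinct $A,B,C,D$: $(C:A\to B).(C:B\to A)=1_A$ and $(C:A\to B).(C:B\to D) = (C:A\to D)$. Axiom 2: for mutually distinct $A,B,C,D$: $(C:A\to B).(D:B\to A).(B:A\to C) = (B:A\to C).(A:C\to D).(B:D\to C)$. Axiom 3: if $(A,B;C,D)\equiv(A',B';C',D')$ then $(A,C;B,D)\equiv(A',C';B',D')$. Axiom 4: for mutually distinct $A,B,C,D$: $(A,B,C;C,A,B) = (A,B,D;D,A,B)$. Under Axioms 1-4: there is a unique involution $\Phi$ on the set $G\setminus\{1\}$ with $\Phi((A,B;C,D)) = (A,C;B,D)$ for all distinct $A,B,C,D$; and the tri-rapports $(A,B,C;C,A,B)$, for distinct $A,B,C$, all represent one and the same element of $G$, denoted $-1$, which satisfies $(-1).(-1)=1$. A projective line groupoid is a groupoid $\mathbb{L}$ with projection structure (satisfying the standing assumptions and Axioms 1-4) such that the set $G\cup\{0\}$, with multiplication extending that of $G$ by $0.\lambda=\lambda.0=0$ and addition given by $0+\lambda=\lambda+0=\lambda$ and, for $\lambda,\mu\in G$, $\lambda+\mu=\lambda.\Phi((-1).\lambda^{-1}.\mu)$ (to be read as $0$ when $(-1).\lambda^{-1}.\mu=1$), is a field $k$; this $k$ is called the scalar field of $\mathbb{L}$.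 For a field $k$, $\mathbb{L}(k^2)$ is the groupoid whose objects are the 1-dimensional linear subspaces of $k^2$ and whose arrows are the linear isomorphisms between them, with the projection structure in which, for distinct 1-dimensional subspaces $A,B,C$, the arrow $C:A\to B$ is the map sending $a\in A$ to the unique $b\in B$ with $a-b\in C$. *)

theory Defs
  imports "Jordan_Normal_Form.Missing_VectorSpace"
begin

section \<open>Groupoids with projection structure\<close>

text \<open>
  Composition is written from left to right: \<open>f \<Zsemi> g\<close> means first \<open>f\<close>, then \<open>g\<close>.
  The arrow \<open>C : A \<rightarrow> B\<close> of a projection structure is written \<open>\<langle>C : A \<rightarrow> B\<rangle>\<close>; it is meaningful only
  when \<open>A\<close>, \<open>B\<close>, \<open>C\<close> are distinct objects.
\<close>

record ('o, 'a) pgpd =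
  Obj :: "'o set"
  Arr :: "'a set"
  Dom :: "'a \<Rightarrow> 'o"
  Cod :: "'a \<Rightarrow> 'o"
  Idt :: "'o \<Rightarrow> 'a"
  Comp :: "'a \<Rightarrow> 'a \<Rightarrow> 'a"  (infixl \<open>\<Zsemi>\<index>\<close> 70)
  Proj :: "'o \<Rightarrow> 'o \<Rightarrow> 'o \<Rightarrow> 'a"  (\<open>\<langle>_ : _ \<rightarrow> _\<rangle>\<index>\<close> [1000, 1000, 1000] 1000)

definition arrows :: "('o, 'a) pgpd \<Rightarrow> 'o \<Rightarrow> 'o \<Rightarrow> 'a set"
  where "arrows L A B = {f \<in> Arr L. Dom L f = A \<and> Cod L f = B}"

definition inverse_arrow :: "('o, 'a) pgpd \<Rightarrow> 'a \<Rightarrow> 'a"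
  where "inverse_arrow L f =
    (THE g. g \<in> arrows L (Cod L f) (Dom L f) \<and>
            f \<Zsemi>\<^bsub>L\<^esub> g = Idt L (Dom L f) \<and> g \<Zsemi>\<^bsub>L\<^esub> f = Idt L (Cod L f))"

locale groupoid =
  fixes L :: "('o, 'a) pgpd" (structure)
  assumes dom_closed: "f \<in> Arr L \<Longrightarrow> Dom L f \<in> Obj L"
    and cod_closed: "f \<in> Arr L \<Longrightarrow> Cod L f \<in> Obj L"
    and id_closed: "A \<in> Obj L \<Longrightarrow> Idt L A \<in> arrows L A A"
    and comp_closed: "\<lbrakk>f \<in> arrows L A B; g \<in> arrows L B C\<rbrakk> \<Longrightarrow> f \<Zsemi> g \<in> arrows L A C"
    and id_left: "f \<in> arrows L A B \<Longrightarrow> Idt L A \<Zsemi> f = f"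
    and id_right: "f \<in> arrows L A B \<Longrightarrow> f \<Zsemi> Idt L B = f"
    and comp_assoc: "\<lbrakk>f \<in> arrows L A B; g \<in> arrows L B C; h \<in> arrows L C D\<rbrakk>
      \<Longrightarrow> (f \<Zsemi> g) \<Zsemi> h = f \<Zsemi> (g \<Zsemi> h)"
    and has_inverse: "f \<in> arrows L A B
      \<Longrightarrow> \<exists>g \<in> arrows L B A. f \<Zsemi> g = Idt L A \<and> g \<Zsemi> f = Idt L B"

locale proj_groupoid = groupoid +
  assumes proj_bij: "\<lbrakk>A \<in> Obj L; B \<in> Obj L; A \<noteq> B\<rbrakk>
    \<Longrightarrow> bij_betw (\<lambda>C. \<langle>C : A \<rightarrow> B\<rangle>) (Obj L - {A, B}) (arrows L A B)"

locale proj_morphism = source: proj_groupoid L + target: proj_groupoid L'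
  for L :: "('o, 'a) pgpd" and L' :: "('p, 'b) pgpd" +
  fixes Fo :: "'o \<Rightarrow> 'p" and Fa :: "'a \<Rightarrow> 'b"
  assumes obj_map: "A \<in> Obj L \<Longrightarrow> Fo A \<in> Obj L'"
    and arr_map: "f \<in> arrows L A B \<Longrightarrow> Fa f \<in> arrows L' (Fo A) (Fo B)"
    and map_id: "A \<in> Obj L \<Longrightarrow> Fa (Idt L A) = Idt L' (Fo A)"
    and map_comp: "\<lbrakk>f \<in> arrows L A B; g \<in> arrows L B C\<rbrakk> \<Longrightarrow> Fa (f \<Zsemi>\<^bsub>L\<^esub> g) = Fa f \<Zsemi>\<^bsub>L'\<^esub> Fa g"
    and obj_inj: "inj_on Fo (Obj L)"
    and map_proj: "\<lbrakk>{A, B, C} \<subseteq> Obj L; distinct [A, B, C]\<rbrakk>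
      \<Longrightarrow> Fa \<langle>C : A \<rightarrow> B\<rangle>\<^bsub>L\<^esub> = \<langle>(Fo C) : (Fo A) \<rightarrow> (Fo B)\<rangle>\<^bsub>L'\<^esub>"

definition proj_isomorphism ::
  "('o, 'a) pgpd \<Rightarrow> ('p, 'b) pgpd \<Rightarrow> ('o \<Rightarrow> 'p) \<Rightarrow> ('a \<Rightarrow> 'b) \<Rightarrow> bool"
  where "proj_isomorphism L L' Fo Fa \<longleftrightarrow> proj_morphism L L' Fo Fa \<and>
    (\<exists>Go Ga. proj_morphism L' L Go Ga \<and>
       (\<forall>A \<in> Obj L. Go (Fo A) = A) \<and> (\<forall>f \<in> Arr L. Ga (Fa f) = f) \<and>
       (\<forall>A \<in> Obj L'. Fo (Go A) = A) \<and> (\<forall>f \<in> Arr L'. Fa (Ga f) = f))"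

definition isomorphic_proj_groupoids :: "('o, 'a) pgpd \<Rightarrow> ('p, 'b) pgpd \<Rightarrow> bool"
  where "isomorphic_proj_groupoids L L' \<longleftrightarrow> (\<exists>Fo Fa. proj_isomorphism L L' Fo Fa)"


section \<open>Abstract scalars\<close>

text \<open>
  \<open>\<mu> \<equiv> \<mu>'\<close> for endo-arrows \<open>\<mu>\<close> of \<open>A\<close> and \<open>\<mu>'\<close> of \<open>B\<close>. Under commutativity of the vertex groups
  the choice of \<open>\<alpha> : A \<rightarrow> B\<close> is irrelevant.
\<close>

definition same_scalar :: "('o, 'a) pgpd \<Rightarrow> 'a \<Rightarrow> 'a \<Rightarrow> bool"
  where "same_scalar L \<mu> \<mu>' \<longleftrightarrow> (\<exists>A \<in> Obj L. \<exists>B \<in> Obj L.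
    \<mu> \<in> arrows L A A \<and> \<mu>' \<in> arrows L B B \<and>
    (\<exists>\<alpha> \<in> arrows L A B. \<mu>' = inverse_arrow L \<alpha> \<Zsemi>\<^bsub>L\<^esub> \<mu> \<Zsemi>\<^bsub>L\<^esub> \<alpha>))"

definition scalar :: "('o, 'a) pgpd \<Rightarrow> 'a \<Rightarrow> 'a set"
  where "scalar L \<mu> = {\<mu>'. same_scalar L \<mu> \<mu>'}"

text \<open>
  An abstract scalar is a \<open>\<equiv>\<close>-class; it contains exactly one arrow of each vertex group, so that
  the product of two classes is formed by composing the representatives at each vertex.
\<close>

definition scalar_group :: "('o, 'a) pgpd \<Rightarrow> 'a set monoid"
  where "scalar_group L =
    \<lparr>carrier = {scalar L \<mu> | \<mu> A. A \<in> Obj L \<and> \<mu> \<in> arrows L A A},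
     monoid.mult = (\<lambda>x y. {\<mu> \<Zsemi>\<^bsub>L\<^esub> \<nu> | \<mu> \<nu>. \<mu> \<in> x \<and> \<nu> \<in> y \<and> Dom L \<mu> = Dom L \<nu>}),
     one = Idt L ` Obj L\<rparr>"

definition cross_ratio :: "('o, 'a) pgpd \<Rightarrow> 'o \<Rightarrow> 'o \<Rightarrow> 'o \<Rightarrow> 'o \<Rightarrow> 'a"
  where "cross_ratio L A B C D = \<langle>C : A \<rightarrow> B\<rangle>\<^bsub>L\<^esub> \<Zsemi>\<^bsub>L\<^esub> \<langle>D : B \<rightarrow> A\<rangle>\<^bsub>L\<^esub>"

definition tri_rapport :: "('o, 'a) pgpd \<Rightarrow> 'o \<Rightarrow> 'o \<Rightarrow> 'o \<Rightarrow> 'o \<Rightarrow> 'o \<Rightarrow> 'o \<Rightarrow> 'a"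
  where "tri_rapport L A B C X Y Z =
    \<langle>X : A \<rightarrow> B\<rangle>\<^bsub>L\<^esub> \<Zsemi>\<^bsub>L\<^esub> \<langle>Y : B \<rightarrow> C\<rangle>\<^bsub>L\<^esub> \<Zsemi>\<^bsub>L\<^esub> \<langle>Z : C \<rightarrow> A\<rangle>\<^bsub>L\<^esub>"

text \<open>
  The unique involution \<open>\<Phi>\<close> of \<open>G - {1}\<close> with \<open>\<Phi> (A, B; C, D) = (A, C; B, D)\<close>, made unique as a
  total function by extensionality. Like the scalar \<open>-1\<close> below, it exists under the axioms of
  \<open>projective_line_groupoid\<close>.
\<close>

definition cross_ratio_involution :: "('o, 'a) pgpd \<Rightarrow> 'a set \<Rightarrow> 'a set"
  where "cross_ratio_involution L = (let S = carrier (scalar_group L) - {\<one>\<^bsub>scalar_group L\<^esub>} in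
    THE \<Phi>. \<Phi> \<in> S \<rightarrow>\<^sub>E S \<and> (\<forall>x \<in> S. \<Phi> (\<Phi> x) = x) \<and>
      (\<forall>A B C D. {A, B, C, D} \<subseteq> Obj L \<and> distinct [A, B, C, D] \<longrightarrow>
         \<Phi> (scalar L (cross_ratio L A B C D)) = scalar L (cross_ratio L A C B D)))"

definition scalar_minus_one :: "('o, 'a) pgpd \<Rightarrow> 'a set"
  where "scalar_minus_one L = (THE e. e \<in> carrier (scalar_group L) \<and>
    (\<forall>A B C. {A, B, C} \<subseteq> Obj L \<and> distinct [A, B, C] \<longrightarrow>
       scalar L (tri_rapport L A B C C A B) = e))"

text \<open>
  \<open>G \<union> {0}\<close>, with \<open>0\<close> represented by \<open>None\<close> and \<open>\<lambda> \<in> G\<close> by \<open>Some \<lambda>\<close>.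
\<close>

definition scalar_mult :: "('o, 'a) pgpd \<Rightarrow> 'a set option \<Rightarrow> 'a set option \<Rightarrow> 'a set option"
  where "scalar_mult L x y = (case (x, y) of
      (Some l, Some m) \<Rightarrow> Some (l \<otimes>\<^bsub>scalar_group L\<^esub> m)
    | _ \<Rightarrow> None)"

definition scalar_add :: "('o, 'a) pgpd \<Rightarrow> 'a set option \<Rightarrow> 'a set option \<Rightarrow> 'a set option"
  where "scalar_add L x y = (case (x, y) of
      (None, _) \<Rightarrow> y
    | (_, None) \<Rightarrow> x
    | (Some l, Some m) \<Rightarrow>
        (let n = scalar_minus_one L \<otimes>\<^bsub>scalar_group L\<^esub> inv\<^bsub>scalar_group L\<^esub> l \<otimes>\<^bsub>scalar_group L\<^esub> m
         in if n = \<one>\<^bsub>scalar_group L\<^esub> then None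
            else Some (l \<otimes>\<^bsub>scalar_group L\<^esub> cross_ratio_involution L n)))"

definition scalar_field :: "('o, 'a) pgpd \<Rightarrow> 'a set option ring"
  where "scalar_field L =
    \<lparr>carrier = insert None (Some ` carrier (scalar_group L)),
     monoid.mult = scalar_mult L,
     one = Some \<one>\<^bsub>scalar_group L\<^esub>,
     zero = None,
     add = scalar_add L\<rparr>"


section \<open>Projective line groupoids\<close>

locale projective_line_groupoid = proj_groupoid +
  assumes three_points: "\<exists>S \<subseteq> Obj L. card S = 3"
    and commutative: "\<lbrakk>\<mu> \<in> arrows L A A; \<nu> \<in> arrows L A A\<rbrakk> \<Longrightarrow> \<mu> \<Zsemi> \<nu> = \<nu> \<Zsemi> \<mu>"
    and axiom1_inverse: "\<lbrakk>{A, B, C} \<subseteq> Obj L; distinct [A, B, C]\<rbrakk>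
      \<Longrightarrow> \<langle>C : A \<rightarrow> B\<rangle> \<Zsemi> \<langle>C : B \<rightarrow> A\<rangle> = Idt L A"
    and axiom1_trans: "\<lbrakk>{A, B, C, D} \<subseteq> Obj L; distinct [A, B, C, D]\<rbrakk>
      \<Longrightarrow> \<langle>C : A \<rightarrow> B\<rangle> \<Zsemi> \<langle>C : B \<rightarrow> D\<rangle> = \<langle>C : A \<rightarrow> D\<rangle>"
    and axiom2: "\<lbrakk>{A, B, C, D} \<subseteq> Obj L; distinct [A, B, C, D]\<rbrakk>
      \<Longrightarrow> \<langle>C : A \<rightarrow> B\<rangle> \<Zsemi> \<langle>D : B \<rightarrow> A\<rangle> \<Zsemi> \<langle>B : A \<rightarrow> C\<rangle>
        = \<langle>B : A \<rightarrow> C\<rangle> \<Zsemi> \<langle>A : C \<rightarrow> D\<rangle> \<Zsemi> \<langle>B : D \<rightarrow> C\<rangle>"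
    and axiom3: "\<lbrakk>{A, B, C, D} \<subseteq> Obj L; distinct [A, B, C, D];
        {A', B', C', D'} \<subseteq> Obj L; distinct [A', B', C', D'];
        same_scalar L (cross_ratio L A B C D) (cross_ratio L A' B' C' D')\<rbrakk>
      \<Longrightarrow> same_scalar L (cross_ratio L A C B D) (cross_ratio L A' C' B' D')"
    and axiom4: "\<lbrakk>{A, B, C, D} \<subseteq> Obj L; distinct [A, B, C, D]\<rbrakk>
      \<Longrightarrow> tri_rapport L A B C C A B = tri_rapport L A B D D A B"
    and scalars_field: "field (scalar_field L)"


section \<open>The groupoid of lines of a plane\<close>

text \<open>The multiplication and the unit of a module record play no role.\<close>

definition coordinate_line :: "'k ring \<Rightarrow> ('k, 'k) module"
  where "coordinate_line K =
    \<lparr>carrier = carrier K, monoid.mult = monoid.mult K, one = \<one>\<^bsub>K\<^esub>,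
     zero = \<zero>\<^bsub>K\<^esub>, add = add K, smult = monoid.mult K\<rparr>"

definition coordinate_plane :: "'k ring \<Rightarrow> ('k, 'k \<times> 'k) module"
  where "coordinate_plane K = direct_sum (coordinate_line K) (coordinate_line K)"

definition subspace_module :: "'k ring \<Rightarrow> ('k \<times> 'k) set \<Rightarrow> ('k, 'k \<times> 'k) module"
  where "subspace_module K A = (coordinate_plane K)\<lparr>carrier := A\<rparr>"

text \<open>The value of \<open>vectorspace.dim\<close> is meaningful only for finite-dimensional spaces.\<close>

definition plane_lines :: "'k ring \<Rightarrow> ('k \<times> 'k) set set"
  where "plane_lines K = {A. subspace K A (coordinate_plane K) \<and>
    vectorspace.fin_dim K (subspace_module K A) \<and> vectorspace.dim K (subspace_module K A) = 1}"

text \<open>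
  An arrow is a triple of domain, codomain and map, the map being extensional so that equality
  of arrows is equality of maps on the domain.
\<close>

definition plane_groupoid ::
  "'k ring \<Rightarrow> (('k \<times> 'k) set, ('k \<times> 'k) set \<times> ('k \<times> 'k) set \<times> ('k \<times> 'k \<Rightarrow> 'k \<times> 'k)) pgpd"
  where "plane_groupoid K =
    \<lparr>Obj = plane_lines K,
     Arr = {(A, B, f). A \<in> plane_lines K \<and> B \<in> plane_lines K \<and> f \<in> extensional A \<and>
       linear_map K (subspace_module K A) (subspace_module K B) f \<and> bij_betw f A B},
     Dom = (\<lambda>(A, B, f). A),
     Cod = (\<lambda>(A, B, f). B),
     Idt = (\<lambda>A. (A, A, restrict id A)),
     Comp = (\<lambda>(A, B, f) (B', C, g). (A, C, compose A g f)),
     Proj = (\<lambda>C A B. (A, B, \<lambda>a \<in> A. THE b. b \<in> B \<and> a \<ominus>\<^bsub>coordinate_plane K\<^esub> b \<in> C))\<rparr>"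

end

theory Submission
  imports Defs
begin

text \<open>
  Choose two points \<open>Q\<close> and \<open>P\<close>. By Axiom 1 the arrows \<open>\<langle>P : A \<rightarrow> B\<rangle>\<close> between points other than \<open>P\<close>
  compose coherently. Hence the arrows \<open>\<gamma> A = \<langle>P : Q \<rightarrow> A\<rangle>\<close>, together with the identity of \<open>Q\<close> and any
  arrow \<open>Q \<rightarrow> P\<close>, form a frame of \<open>L\<close> in which these arrows become trivial: sending \<open>f : A \<rightarrow> B\<close> to the
  scalar of \<open>\<gamma> A . f . (\<gamma> B)\<inverse>\<close> is multiplicative and bijective on each hom-set. So \<open>L\<close> is determined
  by its points and by the scalars \<open>q A B C\<close> of the arrows \<open>\<langle>C : A \<rightarrow> B\<rangle>\<close>, where \<open>q A B P = 1\<close>.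

  In the plane, if \<open>u\<close>, \<open>v\<close>, \<open>w\<close> span the lines \<open>A\<close>, \<open>B\<close>, \<open>C\<close>, the projection \<open>\<langle>C : A \<rightarrow> B\<rangle>\<close> sends \<open>u\<close> to
  \<open>t v\<close> with \<open>t [v, w] = [u, w]\<close>, where the bracket is the determinant (\<open>plane_projection\<close>). It
  therefore suffices to attach to each point \<open>A\<close> a vector \<open>vec A\<close> such that each line is spanned by
  exactly one of them (\<open>line_through_vec_bij\<close>) and \<open>q A B C [vec B, vec C] = [vec A, vec C]\<close>
  (\<open>scalar_bracket\<close>). The vectors are \<open>(1, 0)\<close> for \<open>P\<close> and \<open>(x, 1)\<close> for the others, where \<open>x = 0\<close> for \<open>Q\<close>
  and \<open>x = - q Q P A\<close> for \<open>A \<noteq> Q\<close>; the coordinate \<open>x\<close> is bijective because the arrows \<open>Q \<rightarrow> P\<close> are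
  indexed by the points other than \<open>Q\<close> and \<open>P\<close>.

  For fixed \<open>C\<close> the bracket equation is symmetric and transitive in \<open>A\<close> and \<open>B\<close>, so that it need be
  checked only for \<open>B\<close> a suitable centre. For \<open>C = P\<close> it is the normalization of the frame. For
  \<open>C = Q\<close> it says that the tri-rapport of \<open>A\<close>, \<open>P\<close>, \<open>Q\<close> is \<open>-1\<close>. For the other \<open>C\<close> it is the choice of
  coordinates if \<open>A = P\<close>, and otherwise it is \<open>(A, Q; C, P) = 1 - (A, C; Q, P)\<close>. The last equation
  holds because the addition of \<open>k\<close> was defined from the involution \<open>\<Phi>\<close> in such a way that
  \<open>\<Phi> \<lambda> = 1 - \<lambda>\<close> (\<open>K_involution\<close>). That in turn needs \<open>(-1) (-1) = 1\<close>, which a fourth point provides: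
  with its help Axiom 4 makes the tri-rapport independent of the order of its points
  (\<open>triple_swap\<close>), while reversing the order inverts it.
\<close>

section \<open>Transport of a projection structure along bijections\<close>

context groupoid
begin

lemma arrowsI: "f \<in> Arr L \<Longrightarrow> f \<in> arrows L (Dom L f) (Cod L f)"
  by (simp add: arrows_def)

lemma arrowsD:
  assumes "f \<in> arrows L A B"
  shows "f \<in> Arr L" "Dom L f = A" "Cod L f = B" "A \<in> Obj L" "B \<in> Obj L"
proof -
  show *: "f \<in> Arr L" "Dom L f = A" "Cod L f = B" using assms by (simp_all add: arrows_def)
  show "A \<in> Obj L" "B \<in> Obj L" using dom_closed[OF *(1)] cod_closed[OF *(1)] * by simp_all
qed

end

text \<open>
  Nothing is assumed of \<open>L'\<close> beyond these bijections except that its arrows begin and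
  end at its objects: the axioms of a groupoid with
  projection structure, and the inverse morphism, are carried over along the bijections. For the
  groupoid of lines this replaces a direct verification of those axioms by linear algebra.
\<close>

locale proj_groupoid_bijection = proj_groupoid L for L :: "('o, 'a) pgpd" +
  fixes L' :: "('p, 'b) pgpd" and Fo :: "'o \<Rightarrow> 'p" and Fa :: "'a \<Rightarrow> 'b"
  assumes obj_bij: "bij_betw Fo (Obj L) (Obj L')"
    and arr_bij: "\<lbrakk>A \<in> Obj L; B \<in> Obj L\<rbrakk>
      \<Longrightarrow> bij_betw Fa (arrows L A B) (arrows L' (Fo A) (Fo B))"
    and ends_closed: "f' \<in> Arr L' \<Longrightarrow> Dom L' f' \<in> Obj L' \<and> Cod L' f' \<in> Obj L'"
    and id_preserved: "A \<in> Obj L \<Longrightarrow> Fa (Idt L A) = Idt L' (Fo A)"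
    and comp_preserved: "\<lbrakk>f \<in> arrows L A B; g \<in> arrows L B C\<rbrakk>
      \<Longrightarrow> Fa (f \<Zsemi>\<^bsub>L\<^esub> g) = Fa f \<Zsemi>\<^bsub>L'\<^esub> Fa g"
    and proj_preserved: "\<lbrakk>{A, B, C} \<subseteq> Obj L; distinct [A, B, C]\<rbrakk>
      \<Longrightarrow> Fa \<langle>C : A \<rightarrow> B\<rangle>\<^bsub>L\<^esub> = \<langle>(Fo C) : (Fo A) \<rightarrow> (Fo B)\<rangle>\<^bsub>L'\<^esub>"
begin

lemma Fo_closed: "A \<in> Obj L \<Longrightarrow> Fo A \<in> Obj L'"
  by (rule bij_betw_apply[OF obj_bij])

lemma Fo_eq_iff: "A \<in> Obj L \<Longrightarrow> B \<in> Obj L \<Longrightarrow> Fo A = Fo B \<longleftrightarrow> A = B"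
  using inj_on_eq_iff[OF bij_betw_imp_inj_on[OF obj_bij]] by simp

lemma obj_preimage:
  assumes "A' \<in> Obj L'"
  obtains A where "A \<in> Obj L" "A' = Fo A"
  using assms bij_betw_imp_surj_on[OF obj_bij] by (metis imageE)

lemma Fa_closed: "f \<in> arrows L A B \<Longrightarrow> Fa f \<in> arrows L' (Fo A) (Fo B)"
  using arrowsD(4,5)[of f A B] by (intro bij_betw_apply[OF arr_bij])

lemma arr_preimage:
  assumes "f' \<in> arrows L' (Fo A) (Fo B)" "A \<in> Obj L" "B \<in> Obj L"
  obtains f where "f \<in> arrows L A B" "f' = Fa f"
  using assms bij_betw_imp_surj_on[OF arr_bij, of A B] by (metis imageE)

lemma ends_preimage:
  assumes "f' \<in> arrows L' A' B'"
  obtains A B f where "A \<in> Obj L" "B \<in> Obj L" "A' = Fo A" "B' = Fo B" "f \<in> arrows L A B" "f' = Fa f"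
proof -
  have "f' \<in> Arr L'" "Dom L' f' = A'" "Cod L' f' = B'" using assms by (auto simp: arrows_def)
  then have "A' \<in> Obj L'" "B' \<in> Obj L'" using ends_closed by blast+
  from \<open>A' \<in> Obj L'\<close> obtain A where A: "A \<in> Obj L" "A' = Fo A" by (rule obj_preimage)
  from \<open>B' \<in> Obj L'\<close> obtain B where B: "B \<in> Obj L" "B' = Fo B" by (rule obj_preimage)
  from assms obtain f where f: "f \<in> arrows L A B" "f' = Fa f"
    unfolding A(2) B(2) using A(1) B(1) by (rule arr_preimage)
  show thesis by (rule that[OF A(1) B(1) A(2) B(2) f])
qed

lemma Fa_inj: "inj_on Fa (Arr L)"
proof (rule inj_onI)
  fix f g assume fg: "f \<in> Arr L" "g \<in> Arr L" "Fa f = Fa g"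
  note f = arrowsI[OF fg(1)] and g = arrowsI[OF fg(2)]
  have "Fo (Dom L f) = Fo (Dom L g)" "Fo (Cod L f) = Fo (Cod L g)"
    using Fa_closed[OF f] Fa_closed[OF g] fg(3) by (auto simp: arrows_def)
  then have "g \<in> arrows L (Dom L f) (Cod L f)"
    using g arrowsD[OF f] arrowsD[OF g] Fo_eq_iff by metis
  then show "f = g"
    using inj_onD[OF bij_betw_imp_inj_on[OF arr_bij[OF arrowsD(4,5)[OF f]]] fg(3) f] by simp
qed

lemma target_groupoid: "groupoid L'"
proof (rule groupoid.intro)
  fix f' assume "f' \<in> Arr L'"
  then show "Dom L' f' \<in> Obj L'" "Cod L' f' \<in> Obj L'" using ends_closed by blast+
next
  fix A' assume "A' \<in> Obj L'"
  then obtain A where A: "A \<in> Obj L" "A' = Fo A" by (rule obj_preimage)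
  show "Idt L' A' \<in> arrows L' A' A'"
    using Fa_closed[OF id_closed[OF A(1)]] by (simp add: A id_preserved)
next
  fix f' A' B' g' C' assume fg': "f' \<in> arrows L' A' B'" "g' \<in> arrows L' B' C'"
  from fg'(1) obtain A B f where f: "A \<in> Obj L" "B \<in> Obj L" "A' = Fo A" "B' = Fo B"
    "f \<in> arrows L A B" "f' = Fa f" by (rule ends_preimage)
  from fg'(2) obtain B2 C g where g: "B2 \<in> Obj L" "C \<in> Obj L" "B' = Fo B2" "C' = Fo C"
    "g \<in> arrows L B2 C" "g' = Fa g" by (rule ends_preimage)
  have g': "g \<in> arrows L B C" using f g Fo_eq_iff by metis
  show "f' \<Zsemi>\<^bsub>L'\<^esub> g' \<in> arrows L' A' C'"
    using Fa_closed[OF comp_closed[OF f(5) g']] comp_preserved[OF f(5) g'] by (simp add: f g)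
  fix h' D' assume "h' \<in> arrows L' C' D'"
  then obtain C2 D h where h: "C2 \<in> Obj L" "D \<in> Obj L" "C' = Fo C2" "D' = Fo D"
    "h \<in> arrows L C2 D" "h' = Fa h" by (rule ends_preimage)
  have h': "h \<in> arrows L C D" using g h Fo_eq_iff by metis
  have "Fa ((f \<Zsemi>\<^bsub>L\<^esub> g) \<Zsemi>\<^bsub>L\<^esub> h) = Fa (f \<Zsemi>\<^bsub>L\<^esub> (g \<Zsemi>\<^bsub>L\<^esub> h))"
    using comp_assoc[OF f(5) g' h'] by simp
  then show "(f' \<Zsemi>\<^bsub>L'\<^esub> g') \<Zsemi>\<^bsub>L'\<^esub> h' = f' \<Zsemi>\<^bsub>L'\<^esub> (g' \<Zsemi>\<^bsub>L'\<^esub> h')"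
    by (simp add: f(6) g(6) h(6) comp_preserved[OF f(5) g'] comp_preserved[OF g' h']
        comp_preserved[OF comp_closed[OF f(5) g'] h'] comp_preserved[OF f(5) comp_closed[OF g' h']])
next
  fix f' A' B' assume "f' \<in> arrows L' A' B'"
  then obtain A B f where f: "A \<in> Obj L" "B \<in> Obj L" "A' = Fo A" "B' = Fo B"
    "f \<in> arrows L A B" "f' = Fa f" by (rule ends_preimage)
  show "Idt L' A' \<Zsemi>\<^bsub>L'\<^esub> f' = f'" "f' \<Zsemi>\<^bsub>L'\<^esub> Idt L' B' = f'"
    using f id_closed id_preserved comp_preserved id_left id_right by metis+
  obtain g where g: "g \<in> arrows L B A" "f \<Zsemi>\<^bsub>L\<^esub> g = Idt L A" "g \<Zsemi>\<^bsub>L\<^esub> f = Idt L B"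
    using has_inverse[OF f(5)] by blast
  show "\<exists>g' \<in> arrows L' B' A'. f' \<Zsemi>\<^bsub>L'\<^esub> g' = Idt L' A' \<and> g' \<Zsemi>\<^bsub>L'\<^esub> f' = Idt L' B'"
  proof (intro bexI conjI)
    show "Fa g \<in> arrows L' B' A'" using f g Fa_closed by blast
    show "f' \<Zsemi>\<^bsub>L'\<^esub> Fa g = Idt L' A'"
      using comp_preserved[OF f(5) g(1)] by (simp add: f g id_preserved)
    show "Fa g \<Zsemi>\<^bsub>L'\<^esub> f' = Idt L' B'"
      using comp_preserved[OF g(1) f(5)] by (simp add: f g id_preserved)
  qed
qed

lemma target_proj_groupoid: "proj_groupoid L'"
proof (rule proj_groupoid.intro[OF target_groupoid], rule proj_groupoid_axioms.intro)
  fix A' B' assume A': "A' \<in> Obj L'" and B': "B' \<in> Obj L'" and ne: "A' \<noteq> B'"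
  from A' obtain A where A: "A \<in> Obj L" "A' = Fo A" by (rule obj_preimage)
  from B' obtain B where B: "B \<in> Obj L" "B' = Fo B" by (rule obj_preimage)
  note AB = A(1) B(1) and eq = A(2) B(2)
  have obj: "bij_betw Fo (Obj L - {A, B}) (Obj L' - {A', B'})"
    using bij_betw_DiffI[OF obj_bij, of "{A, B}" "{A', B'}"] AB eq ne
    by (simp add: bij_betw_def inj_on_def Fo_closed Fo_eq_iff)
  have "bij_betw (Fa \<circ> (\<lambda>C. \<langle>C : A \<rightarrow> B\<rangle>\<^bsub>L\<^esub>)) (Obj L - {A, B}) (arrows L' A' B')"
    using proj_bij[OF AB] arr_bij[OF AB] ne unfolding eq by (intro bij_betw_trans) auto
  moreover have "(Fa \<circ> (\<lambda>C. \<langle>C : A \<rightarrow> B\<rangle>\<^bsub>L\<^esub>)) C = ((\<lambda>C'. \<langle>C' : A' \<rightarrow> B'\<rangle>\<^bsub>L'\<^esub>) \<circ> Fo) C"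
    if "C \<in> Obj L - {A, B}" for C
    using that AB ne proj_preserved[of A B C] by (auto simp: eq)
  ultimately have "bij_betw ((\<lambda>C'. \<langle>C' : A' \<rightarrow> B'\<rangle>\<^bsub>L'\<^esub>) \<circ> Fo) (Obj L - {A, B}) (arrows L' A' B')"
    by (subst (asm) bij_betw_cong)
  then show "bij_betw (\<lambda>C'. \<langle>C' : A' \<rightarrow> B'\<rangle>\<^bsub>L'\<^esub>) (Obj L' - {A', B'}) (arrows L' A' B')"
    using bij_betw_comp_iff[OF obj] by blast
qed

lemma isomorphism: "proj_isomorphism L L' Fo Fa"
proof -
  have "proj_morphism L L' Fo Fa"
  proof (rule proj_morphism.intro[OF proj_groupoid_axioms target_proj_groupoid],
      rule proj_morphism_axioms.intro)
    show "inj_on Fo (Obj L)" using obj_bij by (rule bij_betw_imp_inj_on)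
  qed (fact Fo_closed Fa_closed id_preserved comp_preserved proj_preserved)+
  moreover
  define Go where "Go = inv_into (Obj L) Fo"
  define Ga where "Ga = inv_into (Arr L) Fa"
  have Go: "Go (Fo A) = A" if "A \<in> Obj L" for A
    using that obj_bij by (simp add: Go_def bij_betw_inv_into_left)
  have Ga: "Ga (Fa f) = f" if "f \<in> Arr L" for f
    using that Fa_inj by (simp add: Ga_def)
  have Ga_arr: "Ga (Fa f) = f" if "f \<in> arrows L A B" for f A B
    using that Ga arrowsD by blast
  have "proj_morphism L' L Go Ga"
  proof (rule proj_morphism.intro[OF target_proj_groupoid proj_groupoid_axioms],
      rule proj_morphism_axioms.intro)
    fix A' assume "A' \<in> Obj L'"
    then obtain A where A: "A \<in> Obj L" "A' = Fo A" by (rule obj_preimage)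
    show "Go A' \<in> Obj L" using A Go by simp
    have "Ga (Fa (Idt L A)) = Idt L A" using Ga_arr id_closed A by blast
    then show "Ga (Idt L' A') = Idt L (Go A')" using A Go by (simp add: id_preserved)
  next
    fix f' A' B' g' C' assume f': "f' \<in> arrows L' A' B'"
    then obtain A B f where f: "A \<in> Obj L" "B \<in> Obj L" "A' = Fo A" "B' = Fo B"
      "f \<in> arrows L A B" "f' = Fa f" by (rule ends_preimage)
    then show "Ga f' \<in> arrows L (Go A') (Go B')" using Go Ga_arr by simp
    assume g': "g' \<in> arrows L' B' C'"
    then obtain B2 C g where g: "B2 \<in> Obj L" "C \<in> Obj L" "B' = Fo B2" "C' = Fo C"
      "g \<in> arrows L B2 C" "g' = Fa g" by (rule ends_preimage)
    have gB: "g \<in> arrows L B C" using f g Fo_eq_iff by metis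
    have "Ga (Fa (f \<Zsemi>\<^bsub>L\<^esub> g)) = f \<Zsemi>\<^bsub>L\<^esub> g" using Ga_arr comp_closed[OF f(5) gB] by blast
    then show "Ga (f' \<Zsemi>\<^bsub>L'\<^esub> g') = Ga f' \<Zsemi>\<^bsub>L\<^esub> Ga g'"
      using f g Ga_arr comp_preserved[OF f(5) gB] by metis
  next
    show "inj_on Go (Obj L')"
      using obj_bij unfolding Go_def by (meson bij_betw_def bij_betw_inv_into)
  next
    fix A' B' C' assume *: "{A', B', C'} \<subseteq> Obj L'" "distinct [A', B', C']"
    then have A': "A' \<in> Obj L'" and B': "B' \<in> Obj L'" and C': "C' \<in> Obj L'" by auto
    from A' obtain A where A: "A \<in> Obj L" "A' = Fo A" by (rule obj_preimage)
    from B' obtain B where B: "B \<in> Obj L" "B' = Fo B" by (rule obj_preimage)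
    from C' obtain C where C: "C \<in> Obj L" "C' = Fo C" by (rule obj_preimage)
    note ABC = A B C
    have d: "distinct [A, B, C]" using * ABC by auto
    have "\<langle>C : A \<rightarrow> B\<rangle>\<^bsub>L\<^esub> \<in> arrows L A B"
      using proj_bij[of A B] ABC d by (auto dest: bij_betwE)
    then have "Ga (Fa \<langle>C : A \<rightarrow> B\<rangle>\<^bsub>L\<^esub>) = \<langle>C : A \<rightarrow> B\<rangle>\<^bsub>L\<^esub>" by (rule Ga_arr)
    then show "Ga \<langle>C' : A' \<rightarrow> B'\<rangle>\<^bsub>L'\<^esub> = \<langle>(Go C') : (Go A') \<rightarrow> (Go B')\<rangle>\<^bsub>L\<^esub>"
      using proj_preserved[of A B C] ABC d by (simp add: Go)
  qed
  moreover have "Fo (Go A') = A'" if "A' \<in> Obj L'" for A'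
    using that by (rule obj_preimage) (simp add: Go)
  moreover have "Fa (Ga f') = f'" if "f' \<in> Arr L'" for f'
    using groupoid.arrowsI[OF target_groupoid that] by (rule ends_preimage) (simp add: Ga_arr)
  ultimately show ?thesis
    unfolding proj_isomorphism_def using Go Ga by blast
qed

end

section \<open>Inverses and abstract scalars\<close>

context groupoid
begin

lemma inverse_arrow:
  assumes f: "f \<in> arrows L A B"
  shows "inverse_arrow L f \<in> arrows L B A"
    "f \<Zsemi> inverse_arrow L f = Idt L A" "inverse_arrow L f \<Zsemi> f = Idt L B"
proof -
  let ?P = "\<lambda>g. g \<in> arrows L B A \<and> f \<Zsemi> g = Idt L A \<and> g \<Zsemi> f = Idt L B"
  obtain g where g: "?P g" using has_inverse[OF f] by blast
  have "h = g" if "?P h" for h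
    using that g comp_assoc[of h B A f B g A] f id_left[of g B A] id_right[of h B A] by simp
  with g have "?P (THE g. ?P g)" by (rule theI[of ?P g])
  then show "inverse_arrow L f \<in> arrows L B A"
    "f \<Zsemi> inverse_arrow L f = Idt L A" "inverse_arrow L f \<Zsemi> f = Idt L B"
    unfolding inverse_arrow_def arrowsD[OF f] by blast+
qed

lemma comp_inverse_cancel:
  assumes f: "f \<in> arrows L A B"
  shows "h \<in> arrows L A C \<Longrightarrow> f \<Zsemi> (inverse_arrow L f \<Zsemi> h) = h"
    "k \<in> arrows L B C \<Longrightarrow> inverse_arrow L f \<Zsemi> (f \<Zsemi> k) = k"
  using comp_assoc[OF f inverse_arrow(1)[OF f], of h C]
    comp_assoc[OF inverse_arrow(1)[OF f] f, of k C] inverse_arrow(2,3)[OF f]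
    id_left[of h A C] id_left[of k B C] by simp_all

lemma inverse_arrow_eqI:
  assumes "f \<in> arrows L A B" "g \<in> arrows L B A" "f \<Zsemi> g = Idt L A"
  shows "inverse_arrow L f = g"
proof -
  have "inverse_arrow L f \<Zsemi> (f \<Zsemi> g) = g" by (rule comp_inverse_cancel(2)[OF assms(1,2)])
  then show ?thesis using assms(3) id_right[OF inverse_arrow(1)[OF assms(1)]] by simp
qed

lemma conj_closed:
  "\<mu> \<in> arrows L A A \<Longrightarrow> \<alpha> \<in> arrows L A B \<Longrightarrow> inverse_arrow L \<alpha> \<Zsemi> \<mu> \<Zsemi> \<alpha> \<in> arrows L B B"
  by (intro comp_closed inverse_arrow(1))

lemma conj_id:
  assumes \<mu>: "\<mu> \<in> arrows L A A"
  shows "inverse_arrow L (Idt L A) \<Zsemi> \<mu> \<Zsemi> Idt L A = \<mu>"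
proof -
  note i = id_closed[OF arrowsD(4)[OF \<mu>]]
  have "inverse_arrow L (Idt L A) = Idt L A" by (rule inverse_arrow_eqI[OF i i id_left[OF i]])
  then show ?thesis by (simp add: id_left[OF \<mu>] id_right[OF \<mu>])
qed

lemma conj_conj:
  assumes "\<mu> \<in> arrows L A A" "\<alpha> \<in> arrows L A B" "\<beta> \<in> arrows L B C"
  shows "inverse_arrow L \<beta> \<Zsemi> (inverse_arrow L \<alpha> \<Zsemi> \<mu> \<Zsemi> \<alpha>) \<Zsemi> \<beta>
    = inverse_arrow L (\<alpha> \<Zsemi> \<beta>) \<Zsemi> \<mu> \<Zsemi> (\<alpha> \<Zsemi> \<beta>)"
proof -
  note i = inverse_arrow(1)[OF assms(2)] inverse_arrow(1)[OF assms(3)]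
  have "\<alpha> \<Zsemi> \<beta> \<Zsemi> (inverse_arrow L \<beta> \<Zsemi> inverse_arrow L \<alpha>) = Idt L A"
    using comp_assoc[OF assms(2,3) comp_closed[OF i(2,1)]]
      comp_inverse_cancel(1)[OF assms(3) i(1)] inverse_arrow(2)[OF assms(2)] by simp
  then have "inverse_arrow L (\<alpha> \<Zsemi> \<beta>) = inverse_arrow L \<beta> \<Zsemi> inverse_arrow L \<alpha>"
    by (intro inverse_arrow_eqI[OF comp_closed[OF assms(2,3)] comp_closed[OF i(2,1)]])
  moreover have "inverse_arrow L \<beta> \<Zsemi> inverse_arrow L \<alpha> \<Zsemi> \<mu> \<Zsemi> (\<alpha> \<Zsemi> \<beta>) =
      inverse_arrow L \<beta> \<Zsemi> ((inverse_arrow L \<alpha> \<Zsemi> \<mu>) \<Zsemi> (\<alpha> \<Zsemi> \<beta>))"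
    by (simp only: comp_assoc[OF i(2,1) assms(1)]
        comp_assoc[OF i(2) comp_closed[OF i(1) assms(1)] comp_closed[OF assms(2,3)]])
  moreover have "\<dots> = inverse_arrow L \<beta> \<Zsemi> (inverse_arrow L \<alpha> \<Zsemi> \<mu> \<Zsemi> \<alpha>) \<Zsemi> \<beta>"
    by (simp only: comp_assoc[OF comp_closed[OF i(1) assms(1)] assms(2,3), symmetric]
        comp_assoc[OF i(2) conj_closed[OF assms(1,2)] assms(3)])
  ultimately show ?thesis by simp
qed

lemma conj_comp:
  assumes "\<mu> \<in> arrows L A A" "\<nu> \<in> arrows L A A" "\<alpha> \<in> arrows L A B"
  shows "(inverse_arrow L \<alpha> \<Zsemi> \<mu> \<Zsemi> \<alpha>) \<Zsemi> (inverse_arrow L \<alpha> \<Zsemi> \<nu> \<Zsemi> \<alpha>)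
    = inverse_arrow L \<alpha> \<Zsemi> (\<mu> \<Zsemi> \<nu>) \<Zsemi> \<alpha>"
proof -
  note i = inverse_arrow(1)[OF assms(3)]
  note c = comp_closed[OF i assms(1)]
  note d = comp_closed[OF assms(2,3)]
  have "(inverse_arrow L \<alpha> \<Zsemi> \<mu> \<Zsemi> \<alpha>) \<Zsemi> (inverse_arrow L \<alpha> \<Zsemi> \<nu> \<Zsemi> \<alpha>)
      = inverse_arrow L \<alpha> \<Zsemi> \<mu> \<Zsemi> (\<alpha> \<Zsemi> (inverse_arrow L \<alpha> \<Zsemi> (\<nu> \<Zsemi> \<alpha>)))"
    by (simp add: comp_assoc[OF c assms(3) comp_closed[OF i d]] comp_assoc[OF i assms(2,3)])
  also have "\<dots> = inverse_arrow L \<alpha> \<Zsemi> (\<mu> \<Zsemi> \<nu>) \<Zsemi> \<alpha>"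
    by (simp add: comp_inverse_cancel(1)[OF assms(3) d] comp_assoc[OF c assms(2,3), symmetric]
        comp_assoc[OF i assms(1,2)])
  finally show ?thesis .
qed

end

context projective_line_groupoid
begin

lemma proj_arrow:
  assumes "{A, B, C} \<subseteq> Obj L" "distinct [A, B, C]"
  shows "\<langle>C : A \<rightarrow> B\<rangle> \<in> arrows L A B"
  using assms bij_betw_apply[OF proj_bij, of A B C] by auto

lemma proj_arrowE:
  assumes "f \<in> arrows L A B" "A \<noteq> B"
  obtains C where "C \<in> Obj L" "C \<noteq> A" "C \<noteq> B" "f = \<langle>C : A \<rightarrow> B\<rangle>"
proof -
  have "f \<in> (\<lambda>C. \<langle>C : A \<rightarrow> B\<rangle>) ` (Obj L - {A, B})"
    using assms bij_betw_imp_surj_on[OF proj_bij, of A B] arrowsD(4,5)[OF assms(1)] by simp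
  then show thesis using that by auto
qed

lemma some_point:
  obtains A where "A \<in> Obj L"
proof -
  obtain S where S: "S \<subseteq> Obj L" "card S = 3" using three_points by blast
  then have "S \<noteq> {}" by auto
  then show thesis using that S(1) by blast
qed

lemma extra_point:
  assumes "A \<in> Obj L" "B \<in> Obj L"
  obtains C where "C \<in> Obj L" "C \<noteq> A" "C \<noteq> B"
proof -
  obtain S where S: "S \<subseteq> Obj L" "card S = 3" using three_points by blast
  have "card {A, B} \<le> 2" by (simp add: card_insert_if)
  then have "\<not> S \<subseteq> {A, B}" using S(2) card_mono[of "{A, B}" S] by auto
  then show thesis using that S(1) by blast
qed

lemma connected:
  assumes "A \<in> Obj L" "B \<in> Obj L"
  obtains \<alpha> where "\<alpha> \<in> arrows L A B"
proof (cases "A = B")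
  case True
  then show thesis using that id_closed assms by blast
next
  case False
  obtain C where "C \<in> Obj L" "C \<noteq> A" "C \<noteq> B" using assms by (rule extra_point)
  with False assms show thesis using that[of "\<langle>C : A \<rightarrow> B\<rangle>"] proj_arrow by simp
qed

text \<open>
  Two arrows \<open>A \<rightarrow> B\<close> differ by a loop at \<open>A\<close>, and loops at \<open>A\<close> commute with \<open>\<mu>\<close>. This is what makes
  the class \<open>scalar L \<mu>\<close> meet each vertex group in a single arrow.
\<close>

lemma conj_independent:
  assumes \<mu>: "\<mu> \<in> arrows L A A" and \<alpha>: "\<alpha> \<in> arrows L A B" and \<beta>: "\<beta> \<in> arrows L A B"
  shows "inverse_arrow L \<alpha> \<Zsemi> \<mu> \<Zsemi> \<alpha> = inverse_arrow L \<beta> \<Zsemi> \<mu> \<Zsemi> \<beta>"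
proof -
  define \<gamma> where "\<gamma> = \<alpha> \<Zsemi> inverse_arrow L \<beta>"
  have \<gamma>: "\<gamma> \<in> arrows L A A" unfolding \<gamma>_def by (intro comp_closed[OF \<alpha>] inverse_arrow(1) \<beta>)
  have "\<gamma> \<Zsemi> \<beta> = \<alpha> \<Zsemi> (inverse_arrow L \<beta> \<Zsemi> \<beta>)"
    unfolding \<gamma>_def by (rule comp_assoc[OF \<alpha> inverse_arrow(1)[OF \<beta>] \<beta>])
  then have \<alpha>_eq: "\<alpha> = \<gamma> \<Zsemi> \<beta>" using inverse_arrow(3)[OF \<beta>] id_right[OF \<alpha>] by simp
  have "inverse_arrow L \<gamma> \<Zsemi> \<mu> \<Zsemi> \<gamma> = inverse_arrow L \<gamma> \<Zsemi> (\<gamma> \<Zsemi> \<mu>)"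
    using comp_assoc[OF inverse_arrow(1)[OF \<gamma>] \<mu> \<gamma>] commutative[OF \<mu> \<gamma>] by simp
  then have "inverse_arrow L \<gamma> \<Zsemi> \<mu> \<Zsemi> \<gamma> = \<mu>" using comp_inverse_cancel(2)[OF \<gamma> \<mu>] by simp
  then show ?thesis using conj_conj[OF \<mu> \<gamma> \<beta>] \<alpha>_eq by simp
qed

lemma scalar_eq:
  assumes "\<mu> \<in> arrows L A A"
  shows "scalar L \<mu> = {inverse_arrow L \<alpha> \<Zsemi> \<mu> \<Zsemi> \<alpha> | \<alpha> B. \<alpha> \<in> arrows L A B}"
proof -
  have "same_scalar L \<mu> \<nu> \<longleftrightarrow>
      (\<exists>\<alpha> B. \<nu> = inverse_arrow L \<alpha> \<Zsemi> \<mu> \<Zsemi> \<alpha> \<and> \<alpha> \<in> arrows L A B)" for \<nu>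
  proof
    assume "same_scalar L \<mu> \<nu>"
    then obtain A' B \<alpha> where *: "\<mu> \<in> arrows L A' A'" "\<alpha> \<in> arrows L A' B"
      "\<nu> = inverse_arrow L \<alpha> \<Zsemi> \<mu> \<Zsemi> \<alpha>" unfolding same_scalar_def by blast
    then have "A' = A" using assms by (simp add: arrows_def)
    with * show "\<exists>\<alpha> B. \<nu> = inverse_arrow L \<alpha> \<Zsemi> \<mu> \<Zsemi> \<alpha> \<and> \<alpha> \<in> arrows L A B" by blast
  next
    assume "\<exists>\<alpha> B. \<nu> = inverse_arrow L \<alpha> \<Zsemi> \<mu> \<Zsemi> \<alpha> \<and> \<alpha> \<in> arrows L A B"
    then obtain \<alpha> B where *: "\<alpha> \<in> arrows L A B" "\<nu> = inverse_arrow L \<alpha> \<Zsemi> \<mu> \<Zsemi> \<alpha>" by blast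
    then show "same_scalar L \<mu> \<nu>"
      unfolding same_scalar_def using assms conj_closed[OF assms *(1)] arrowsD(4,5)[OF *(1)] by blast
  qed
  then show ?thesis unfolding scalar_def by (rule Collect_cong)
qed

lemma scalar_conj:
  assumes \<mu>: "\<mu> \<in> arrows L A A" and \<alpha>: "\<alpha> \<in> arrows L A B"
  shows "scalar L (inverse_arrow L \<alpha> \<Zsemi> \<mu> \<Zsemi> \<alpha>) = scalar L \<mu>"
proof -
  have "\<exists>\<gamma> C. x = inverse_arrow L \<gamma> \<Zsemi> \<mu> \<Zsemi> \<gamma> \<and> \<gamma> \<in> arrows L A C"
    if "x = inverse_arrow L \<beta> \<Zsemi> (inverse_arrow L \<alpha> \<Zsemi> \<mu> \<Zsemi> \<alpha>) \<Zsemi> \<beta>" "\<beta> \<in> arrows L B C" for x \<beta> C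
    using that conj_conj[OF \<mu> \<alpha>] comp_closed[OF \<alpha>] by metis
  moreover have "\<exists>\<beta> C. x = inverse_arrow L \<beta> \<Zsemi> (inverse_arrow L \<alpha> \<Zsemi> \<mu> \<Zsemi> \<alpha>) \<Zsemi> \<beta> \<and> \<beta> \<in> arrows L B C"
    if "x = inverse_arrow L \<gamma> \<Zsemi> \<mu> \<Zsemi> \<gamma>" "\<gamma> \<in> arrows L A C" for x \<gamma> C
  proof (intro exI conjI)
    show i: "inverse_arrow L \<alpha> \<Zsemi> \<gamma> \<in> arrows L B C"
      by (rule comp_closed[OF inverse_arrow(1)[OF \<alpha>] that(2)])
    show "x = inverse_arrow L (inverse_arrow L \<alpha> \<Zsemi> \<gamma>) \<Zsemi> (inverse_arrow L \<alpha> \<Zsemi> \<mu> \<Zsemi> \<alpha>) \<Zsemi> (inverse_arrow L \<alpha> \<Zsemi> \<gamma>)"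
      using conj_conj[OF \<mu> \<alpha> i] comp_inverse_cancel(1)[OF \<alpha> that(2)] that(1) by simp
  qed
  ultimately show ?thesis
    unfolding scalar_eq[OF \<mu>] scalar_eq[OF conj_closed[OF \<mu> \<alpha>]] by (intro equalityI subsetI) (simp, metis)+
qed

lemma scalar_at:
  assumes \<mu>: "\<mu> \<in> arrows L A A" and B: "B \<in> Obj L"
  obtains \<nu> where "\<nu> \<in> arrows L B B" "scalar L \<nu> = scalar L \<mu>"
proof -
  obtain \<alpha> where "\<alpha> \<in> arrows L A B" using arrowsD(4)[OF \<mu>] B by (rule connected)
  then show thesis using that conj_closed[OF \<mu>] scalar_conj[OF \<mu>] by blast
qed

lemma mem_scalar: "\<mu> \<in> arrows L A A \<Longrightarrow> \<mu> \<in> scalar L \<mu>"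
proof -
  assume \<mu>: "\<mu> \<in> arrows L A A"
  note i = id_closed[OF arrowsD(4)[OF \<mu>]]
  have "\<exists>\<alpha> B. \<mu> = inverse_arrow L \<alpha> \<Zsemi> \<mu> \<Zsemi> \<alpha> \<and> \<alpha> \<in> arrows L A B"
    using i conj_id[OF \<mu>] by metis
  then show ?thesis unfolding scalar_eq[OF \<mu>] by simp
qed

lemma scalar_inj:
  assumes \<mu>: "\<mu> \<in> arrows L A A" and \<nu>: "\<nu> \<in> arrows L A A" and eq: "scalar L \<mu> = scalar L \<nu>"
  shows "\<mu> = \<nu>"
proof -
  have "\<nu> \<in> scalar L \<mu>" using mem_scalar[OF \<nu>] eq by simp
  then obtain \<alpha> B where \<alpha>: "\<alpha> \<in> arrows L A B" "\<nu> = inverse_arrow L \<alpha> \<Zsemi> \<mu> \<Zsemi> \<alpha>"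
    unfolding scalar_eq[OF \<mu>] by blast
  then have "B = A" using conj_closed[OF \<mu>, of \<alpha> B] arrowsD(2)[OF \<nu>] by (simp add: arrows_def)
  then have "\<alpha> \<in> arrows L A A" using \<alpha>(1) by simp
  note i = id_closed[OF arrowsD(4)[OF \<mu>]]
  then show ?thesis using conj_independent[OF \<mu> \<open>\<alpha> \<in> arrows L A A\<close> i] \<alpha>(2) conj_id[OF \<mu>] by simp
qed

abbreviation G where "G \<equiv> scalar_group L"

lemma carrier_G: "A \<in> Obj L \<Longrightarrow> carrier G = scalar L ` arrows L A A"
proof -
  assume A: "A \<in> Obj L"
  have "scalar L \<mu> \<in> scalar L ` arrows L A A" if \<mu>: "\<mu> \<in> arrows L B B" for \<mu> B
    using \<mu> A by (rule scalar_at) (metis imageI)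
  then show ?thesis using A unfolding scalar_group_def by auto
qed

lemma scalar_closed: "\<mu> \<in> arrows L A A \<Longrightarrow> scalar L \<mu> \<in> carrier G"
  using carrier_G[of A] arrowsD(4)[of \<mu> A A] by simp

lemma scalarE:
  assumes "x \<in> carrier G" "A \<in> Obj L"
  obtains \<mu> where "\<mu> \<in> arrows L A A" "x = scalar L \<mu>"
  using assms carrier_G[OF assms(2)] that by auto

lemma scalar_comp:
  assumes \<mu>: "\<mu> \<in> arrows L A A" and \<nu>: "\<nu> \<in> arrows L A A"
  shows "scalar L (\<mu> \<Zsemi> \<nu>) = scalar L \<mu> \<otimes>\<^bsub>G\<^esub> scalar L \<nu>"
proof -
  have "scalar L \<mu> \<otimes>\<^bsub>G\<^esub> scalar L \<nu> =
      {x \<Zsemi> y | x y. x \<in> scalar L \<mu> \<and> y \<in> scalar L \<nu> \<and> Dom L x = Dom L y}"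
    by (simp add: scalar_group_def)
  also have "\<dots> = {inverse_arrow L \<alpha> \<Zsemi> (\<mu> \<Zsemi> \<nu>) \<Zsemi> \<alpha> | \<alpha> B. \<alpha> \<in> arrows L A B}"
  proof (intro equalityI subsetI)
    fix z assume "z \<in> {x \<Zsemi> y | x y. x \<in> scalar L \<mu> \<and> y \<in> scalar L \<nu> \<and> Dom L x = Dom L y}"
    then obtain \<alpha> \<beta> B C where \<alpha>: "\<alpha> \<in> arrows L A B" and \<beta>: "\<beta> \<in> arrows L A C"
      and d: "Dom L (inverse_arrow L \<alpha> \<Zsemi> \<mu> \<Zsemi> \<alpha>) = Dom L (inverse_arrow L \<beta> \<Zsemi> \<nu> \<Zsemi> \<beta>)"
      and z: "z = (inverse_arrow L \<alpha> \<Zsemi> \<mu> \<Zsemi> \<alpha>) \<Zsemi> (inverse_arrow L \<beta> \<Zsemi> \<nu> \<Zsemi> \<beta>)"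
      unfolding scalar_eq[OF \<mu>] scalar_eq[OF \<nu>] by blast
    have "B = C" using d conj_closed[OF \<mu> \<alpha>] conj_closed[OF \<nu> \<beta>] by (simp add: arrows_def)
    then have "\<beta> \<in> arrows L A B" using \<beta> by simp
    then have "z = inverse_arrow L \<alpha> \<Zsemi> (\<mu> \<Zsemi> \<nu>) \<Zsemi> \<alpha>"
      using z conj_independent[OF \<nu> \<alpha>] conj_comp[OF \<mu> \<nu> \<alpha>] by simp
    then show "z \<in> {inverse_arrow L \<alpha> \<Zsemi> (\<mu> \<Zsemi> \<nu>) \<Zsemi> \<alpha> | \<alpha> B. \<alpha> \<in> arrows L A B}"
      using \<alpha> by blast
  next
    fix z assume "z \<in> {inverse_arrow L \<alpha> \<Zsemi> (\<mu> \<Zsemi> \<nu>) \<Zsemi> \<alpha> | \<alpha> B. \<alpha> \<in> arrows L A B}"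
    then obtain \<alpha> B where \<alpha>: "\<alpha> \<in> arrows L A B" and z: "z = inverse_arrow L \<alpha> \<Zsemi> (\<mu> \<Zsemi> \<nu>) \<Zsemi> \<alpha>" by blast
    have "z = (inverse_arrow L \<alpha> \<Zsemi> \<mu> \<Zsemi> \<alpha>) \<Zsemi> (inverse_arrow L \<alpha> \<Zsemi> \<nu> \<Zsemi> \<alpha>)"
      using z conj_comp[OF \<mu> \<nu> \<alpha>] by simp
    moreover have "Dom L (inverse_arrow L \<alpha> \<Zsemi> \<mu> \<Zsemi> \<alpha>) = Dom L (inverse_arrow L \<alpha> \<Zsemi> \<nu> \<Zsemi> \<alpha>)"
      using conj_closed[OF \<mu> \<alpha>] conj_closed[OF \<nu> \<alpha>] by (simp add: arrows_def)
    moreover have "inverse_arrow L \<alpha> \<Zsemi> \<mu> \<Zsemi> \<alpha> \<in> scalar L \<mu>" "inverse_arrow L \<alpha> \<Zsemi> \<nu> \<Zsemi> \<alpha> \<in> scalar L \<nu>"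
      using \<alpha> scalar_eq[OF \<mu>] scalar_eq[OF \<nu>] by blast+
    ultimately show "z \<in> {x \<Zsemi> y | x y. x \<in> scalar L \<mu> \<and> y \<in> scalar L \<nu> \<and> Dom L x = Dom L y}"
      by blast
  qed
  finally show ?thesis by (simp add: scalar_eq[OF comp_closed[OF \<mu> \<nu>]])
qed

lemma scalar_id:
  assumes A: "A \<in> Obj L"
  shows "scalar L (Idt L A) = \<one>\<^bsub>G\<^esub>"
proof -
  have c: "inverse_arrow L \<alpha> \<Zsemi> Idt L A \<Zsemi> \<alpha> = Idt L B" if "\<alpha> \<in> arrows L A B" for \<alpha> B
    using that inverse_arrow[OF that] id_right by simp
  have "Idt L B \<in> {inverse_arrow L \<alpha> \<Zsemi> Idt L A \<Zsemi> \<alpha> | \<alpha> B. \<alpha> \<in> arrows L A B}" if "B \<in> Obj L" for B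
  proof -
    obtain \<alpha> where \<alpha>: "\<alpha> \<in> arrows L A B" using A \<open>B \<in> Obj L\<close> by (rule connected)
    from c[OF \<alpha>] \<alpha> have "\<exists>\<alpha> B'. Idt L B = inverse_arrow L \<alpha> \<Zsemi> Idt L A \<Zsemi> \<alpha> \<and> \<alpha> \<in> arrows L A B'"
      by metis
    then show ?thesis by simp
  qed
  moreover have "x \<in> Idt L ` Obj L" if "x \<in> {inverse_arrow L \<alpha> \<Zsemi> Idt L A \<Zsemi> \<alpha> | \<alpha> B. \<alpha> \<in> arrows L A B}" for x
  proof -
    obtain \<alpha> B where "x = inverse_arrow L \<alpha> \<Zsemi> Idt L A \<Zsemi> \<alpha>" "\<alpha> \<in> arrows L A B"
      using \<open>x \<in> _\<close> by blast
    then have "x = Idt L B" "B \<in> Obj L" using c arrowsD(5) by simp_all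
    then show ?thesis by blast
  qed
  ultimately have "{inverse_arrow L \<alpha> \<Zsemi> Idt L A \<Zsemi> \<alpha> | \<alpha> B. \<alpha> \<in> arrows L A B} = Idt L ` Obj L"
    by blast
  then show ?thesis using scalar_eq[OF id_closed[OF A]] by (simp add: scalar_group_def)
qed

lemma scalar_group_comm_group: "comm_group G"
proof -
  obtain A where A: "A \<in> Obj L" by (rule some_point)
  show ?thesis
  proof (rule comm_groupI)
    fix x y assume "x \<in> carrier G" "y \<in> carrier G"
    then obtain \<mu> \<nu> where *: "\<mu> \<in> arrows L A A" "x = scalar L \<mu>" "\<nu> \<in> arrows L A A" "y = scalar L \<nu>"
      using A by (metis scalarE)
    show "x \<otimes>\<^bsub>G\<^esub> y \<in> carrier G"
      using * scalar_closed[OF comp_closed] by (simp flip: scalar_comp)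
    show "x \<otimes>\<^bsub>G\<^esub> y = y \<otimes>\<^bsub>G\<^esub> x" using * commutative by (simp flip: scalar_comp)
    fix z assume "z \<in> carrier G"
    then obtain \<rho> where \<rho>: "\<rho> \<in> arrows L A A" "z = scalar L \<rho>" using A by (metis scalarE)
    have "x \<otimes>\<^bsub>G\<^esub> y \<otimes>\<^bsub>G\<^esub> z = scalar L (\<mu> \<Zsemi> \<nu> \<Zsemi> \<rho>)"
      using * \<rho> comp_closed[OF *(1,3)] by (simp add: scalar_comp)
    moreover have "x \<otimes>\<^bsub>G\<^esub> (y \<otimes>\<^bsub>G\<^esub> z) = scalar L (\<mu> \<Zsemi> (\<nu> \<Zsemi> \<rho>))"
      using * \<rho> comp_closed[OF *(3) \<rho>(1)] by (simp add: scalar_comp)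
    ultimately show "x \<otimes>\<^bsub>G\<^esub> y \<otimes>\<^bsub>G\<^esub> z = x \<otimes>\<^bsub>G\<^esub> (y \<otimes>\<^bsub>G\<^esub> z)"
      using comp_assoc[OF *(1,3) \<rho>(1)] by simp
  next
    show "\<one>\<^bsub>G\<^esub> \<in> carrier G" using scalar_closed[OF id_closed[OF A]] scalar_id[OF A] by simp
  next
    fix x assume "x \<in> carrier G"
    then obtain \<mu> where \<mu>: "\<mu> \<in> arrows L A A" "x = scalar L \<mu>" using A by (metis scalarE)
    then show "\<one>\<^bsub>G\<^esub> \<otimes>\<^bsub>G\<^esub> x = x"
      using id_closed[OF A] id_left by (simp flip: scalar_id[OF A] scalar_comp)
    have "scalar L (inverse_arrow L \<mu>) \<otimes>\<^bsub>G\<^esub> x = \<one>\<^bsub>G\<^esub>"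
      using \<mu> inverse_arrow[OF \<mu>(1)] by (simp flip: scalar_id[OF A] scalar_comp)
    then show "\<exists>y \<in> carrier G. y \<otimes>\<^bsub>G\<^esub> x = \<one>\<^bsub>G\<^esub>"
      using scalar_closed[OF inverse_arrow(1)[OF \<mu>(1)]] by blast
  qed
qed

sublocale G: comm_group G
  by (rule scalar_group_comm_group)

end

section \<open>Cross ratios, the involution and frames\<close>

context projective_line_groupoid
begin

lemma same_scalar_iff:
  assumes "\<mu> \<in> arrows L A A" "\<nu> \<in> arrows L B B"
  shows "same_scalar L \<mu> \<nu> \<longleftrightarrow> scalar L \<mu> = scalar L \<nu>"
proof
  assume "same_scalar L \<mu> \<nu>"
  then have "\<nu> \<in> scalar L \<mu>" by (simp add: scalar_def)
  then obtain \<alpha> C where "\<alpha> \<in> arrows L A C" "\<nu> = inverse_arrow L \<alpha> \<Zsemi> \<mu> \<Zsemi> \<alpha>"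
    unfolding scalar_eq[OF assms(1)] by blast
  then show "scalar L \<mu> = scalar L \<nu>" using scalar_conj[OF assms(1)] by metis
next
  assume "scalar L \<mu> = scalar L \<nu>"
  then have "\<nu> \<in> scalar L \<mu>" using mem_scalar[OF assms(2)] by simp
  then show "same_scalar L \<mu> \<nu>" by (simp add: scalar_def)
qed

lemma cross_ratio_loop:
  "\<lbrakk>{A, B, C, D} \<subseteq> Obj L; distinct [A, B, C, D]\<rbrakk> \<Longrightarrow> cross_ratio L A B C D \<in> arrows L A A"
  unfolding cross_ratio_def by (rule comp_closed[of _ A B]; rule proj_arrow; simp; blast)

text \<open>
  By Axiom 1 the inverse of \<open>\<langle>C : A \<rightarrow> B\<rangle>\<close> is \<open>\<langle>C : B \<rightarrow> A\<rangle>\<close>, which differs from \<open>\<langle>D : B \<rightarrow> A\<rangle>\<close> because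
  distinct points name distinct arrows.
\<close>

lemma cross_ratio_nontrivial:
  assumes X: "{A, B, C, D} \<subseteq> Obj L" "distinct [A, B, C, D]"
  shows "scalar L (cross_ratio L A B C D) \<noteq> \<one>\<^bsub>G\<^esub>"
proof
  have A: "A \<in> Obj L" using X by simp
  have a: "\<langle>C : A \<rightarrow> B\<rangle> \<in> arrows L A B" "\<langle>C : B \<rightarrow> A\<rangle> \<in> arrows L B A" "\<langle>D : B \<rightarrow> A\<rangle> \<in> arrows L B A"
    using X by (auto intro!: proj_arrow)
  assume "scalar L (cross_ratio L A B C D) = \<one>\<^bsub>G\<^esub>"
  then have "cross_ratio L A B C D = Idt L A"
    using scalar_inj[OF cross_ratio_loop[OF X] id_closed[OF A]] scalar_id[OF A] by simp
  then have "inverse_arrow L \<langle>C : A \<rightarrow> B\<rangle> = \<langle>D : B \<rightarrow> A\<rangle>"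
    unfolding cross_ratio_def by (rule inverse_arrow_eqI[OF a(1,3)])
  moreover have "inverse_arrow L \<langle>C : A \<rightarrow> B\<rangle> = \<langle>C : B \<rightarrow> A\<rangle>"
    using X by (intro inverse_arrow_eqI[OF a(1,2)] axiom1_inverse) auto
  ultimately have "\<langle>C : B \<rightarrow> A\<rangle> = \<langle>D : B \<rightarrow> A\<rangle>" by simp
  then show False
    using inj_onD[OF bij_betw_imp_inj_on[OF proj_bij[of B A]], of C D] X by auto
qed

text \<open>
  Every arrow \<open>B \<rightarrow> A\<close> is some \<open>\<langle>D : B \<rightarrow> A\<rangle>\<close>, so with \<open>A\<close>, \<open>B\<close>, \<open>C\<close> held fixed the cross ratios
  already run through all scalars different from \<open>1\<close>.
\<close>

lemma cross_ratio_exhaustive: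
  assumes "x \<in> carrier G" "x \<noteq> \<one>\<^bsub>G\<^esub>"
  obtains A B C D where "{A, B, C, D} \<subseteq> Obj L" "distinct [A, B, C, D]"
    "x = scalar L (cross_ratio L A B C D)"
proof -
  obtain A where A: "A \<in> Obj L" by (rule some_point)
  obtain B where B: "B \<in> Obj L" "B \<noteq> A" using extra_point[OF A A] by metis
  obtain C where C: "C \<in> Obj L" "C \<noteq> A" "C \<noteq> B" using extra_point[OF A B(1)] by metis
  obtain \<mu> where \<mu>: "\<mu> \<in> arrows L A A" "x = scalar L \<mu>" using assms(1) A by (rule scalarE)
  have a: "\<langle>C : A \<rightarrow> B\<rangle> \<in> arrows L A B" "\<langle>C : B \<rightarrow> A\<rangle> \<in> arrows L B A"
    using A B C by (auto intro!: proj_arrow)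
  have ac: "\<langle>C : A \<rightarrow> B\<rangle> \<Zsemi> \<langle>C : B \<rightarrow> A\<rangle> = Idt L A" "\<langle>C : B \<rightarrow> A\<rangle> \<Zsemi> \<langle>C : A \<rightarrow> B\<rangle> = Idt L B"
    using A B C by (auto intro!: axiom1_inverse)
  obtain D where D: "D \<in> Obj L" "D \<noteq> B" "D \<noteq> A" "\<langle>C : B \<rightarrow> A\<rangle> \<Zsemi> \<mu> = \<langle>D : B \<rightarrow> A\<rangle>"
    using comp_closed[OF a(2) \<mu>(1)] B(2) by (rule proj_arrowE)
  have "cross_ratio L A B C D = \<langle>C : A \<rightarrow> B\<rangle> \<Zsemi> \<langle>C : B \<rightarrow> A\<rangle> \<Zsemi> \<mu>"
    unfolding cross_ratio_def D(4)[symmetric] by (rule comp_assoc[OF a \<mu>(1), symmetric])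
  then have \<mu>_eq: "cross_ratio L A B C D = \<mu>" using ac id_left[OF \<mu>(1)] by simp
  have "D \<noteq> C"
  proof
    assume "D = C"
    then have "\<mu> = Idt L A" using \<mu>_eq ac unfolding cross_ratio_def by simp
    then show False using assms(2) \<mu>(2) scalar_id[OF A] by simp
  qed
  then show thesis using that[of A B C D] A B C D \<mu>(2) \<mu>_eq by auto
qed

text \<open>
  The relation between \<open>(A, B; C, D)\<close> and \<open>(A, C; B, D)\<close> is symmetric, it is a function by Axiom 3, and
  it is total because cross ratios exhaust the scalars different from \<open>1\<close>. It is therefore
  the graph of the only function that satisfies the description of the involution.
\<close>

lemma cross_ratio_involution_apply:
  assumes "{A, B, C, D} \<subseteq> Obj L" "distinct [A, B, C, D]"
  shows "cross_ratio_involution L (scalar L (cross_ratio L A B C D)) = scalar L (cross_ratio L A C B D)"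
proof -
  define S where "S = carrier G - {\<one>\<^bsub>G\<^esub>}"
  define R where "R x y \<longleftrightarrow> (\<exists>A B C D. {A, B, C, D} \<subseteq> Obj L \<and> distinct [A, B, C, D] \<and>
    x = scalar L (cross_ratio L A B C D) \<and> y = scalar L (cross_ratio L A C B D))" for x y
  define P where "P \<Phi> \<longleftrightarrow> \<Phi> \<in> S \<rightarrow>\<^sub>E S \<and> (\<forall>x \<in> S. \<Phi> (\<Phi> x) = x) \<and>
      (\<forall>A B C D. {A, B, C, D} \<subseteq> Obj L \<and> distinct [A, B, C, D] \<longrightarrow>
         \<Phi> (scalar L (cross_ratio L A B C D)) = scalar L (cross_ratio L A C B D))" for \<Phi>
  have RI: "R (scalar L (cross_ratio L A B C D)) (scalar L (cross_ratio L A C B D))"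
    if "{A, B, C, D} \<subseteq> Obj L" "distinct [A, B, C, D]" for A B C D
    using that unfolding R_def by blast
  have R_fun: "y = y'" if xy: "R x y" and xy': "R x y'" for x y y'
  proof -
    obtain A B C D where 1: "{A, B, C, D} \<subseteq> Obj L" "distinct [A, B, C, D]"
      "x = scalar L (cross_ratio L A B C D)" "y = scalar L (cross_ratio L A C B D)"
      using xy unfolding R_def by blast
    obtain A' B' C' D' where 2: "{A', B', C', D'} \<subseteq> Obj L" "distinct [A', B', C', D']"
      "x = scalar L (cross_ratio L A' B' C' D')" "y' = scalar L (cross_ratio L A' C' B' D')"
      using xy' unfolding R_def by blast
    have X1: "{A, C, B, D} \<subseteq> Obj L" "distinct [A, C, B, D]" using 1 by auto
    have X2: "{A', C', B', D'} \<subseteq> Obj L" "distinct [A', C', B', D']" using 2 by auto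
    have "same_scalar L (cross_ratio L A B C D) (cross_ratio L A' B' C' D')"
      using same_scalar_iff[OF cross_ratio_loop[OF 1(1,2)] cross_ratio_loop[OF 2(1,2)]] 1(3) 2(3) by simp
    then have "same_scalar L (cross_ratio L A C B D) (cross_ratio L A' C' B' D')"
      by (rule axiom3[OF 1(1,2) 2(1,2)])
    then show ?thesis
      using same_scalar_iff[OF cross_ratio_loop[OF X1] cross_ratio_loop[OF X2]] 1(4) 2(4) by simp
  qed
  have R_sym: "R y x" if "R x y" for x y
  proof -
    obtain A B C D where 1: "{A, B, C, D} \<subseteq> Obj L" "distinct [A, B, C, D]"
      "x = scalar L (cross_ratio L A B C D)" "y = scalar L (cross_ratio L A C B D)"
      using \<open>R x y\<close> unfolding R_def by blast
    have "{A, C, B, D} \<subseteq> Obj L" "distinct [A, C, B, D]" using 1 by auto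
    then show ?thesis using RI[of A C B D] 1(3,4) by simp
  qed
  have R_S: "x \<in> S" if "R x y" for x y
  proof -
    obtain A B C D where 1: "{A, B, C, D} \<subseteq> Obj L" "distinct [A, B, C, D]"
      "x = scalar L (cross_ratio L A B C D)"
      using \<open>R x y\<close> unfolding R_def by blast
    then show ?thesis
      using scalar_closed[OF cross_ratio_loop[OF 1(1,2)]] cross_ratio_nontrivial[OF 1(1,2)]
      unfolding S_def by simp
  qed
  have R_ex: "\<exists>y. R x y" if "x \<in> S" for x
  proof -
    have "x \<in> carrier G" "x \<noteq> \<one>\<^bsub>G\<^esub>" using \<open>x \<in> S\<close> unfolding S_def by auto
    then obtain A B C D where "{A, B, C, D} \<subseteq> Obj L" "distinct [A, B, C, D]"
      "x = scalar L (cross_ratio L A B C D)" by (rule cross_ratio_exhaustive)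
    then show ?thesis using RI by blast
  qed
  \<comment> \<open>The involution, obtained from its graph \<open>R\<close>; the description \<open>P\<close> then forces every solution to equal it.\<close>
  define \<Psi> where "\<Psi> = (\<lambda>x \<in> S. THE y. R x y)"
  have \<Psi>: "\<Psi> x = y" if "R x y" for x y
  proof -
    have "(THE y. R x y) = y" using that R_fun[OF _ that] by (rule the_equality)
    then show ?thesis using R_S[OF that] unfolding \<Psi>_def by simp
  qed
  have "P \<Psi>"
    unfolding P_def
  proof (intro conjI ballI allI impI)
    show "\<Psi> \<in> S \<rightarrow>\<^sub>E S"
    proof (rule PiE_I)
      fix x assume "x \<in> S"
      then obtain y where "R x y" using R_ex by blast
      then show "\<Psi> x \<in> S" using \<Psi> R_sym R_S by metis
    qed (simp add: \<Psi>_def)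
  next
    fix x assume "x \<in> S"
    then obtain y where "R x y" using R_ex by blast
    then show "\<Psi> (\<Psi> x) = x" using \<Psi> R_sym by metis
  next
    fix A B C D assume "{A, B, C, D} \<subseteq> Obj L \<and> distinct [A, B, C, D]"
    then show "\<Psi> (scalar L (cross_ratio L A B C D)) = scalar L (cross_ratio L A C B D)"
      by (intro \<Psi> RI) auto
  qed
  moreover have "\<Phi> = \<Psi>" if \<Phi>: "P \<Phi>" for \<Phi>
  proof (rule extensionalityI[of _ S])
    show "\<Phi> \<in> extensional S" using \<Phi> unfolding P_def by (simp add: PiE_def)
    show "\<Psi> \<in> extensional S" by (simp add: \<Psi>_def)
    fix x assume "x \<in> S"
    then obtain y where y: "R x y" using R_ex by blast
    then obtain A B C D where 1: "{A, B, C, D} \<subseteq> Obj L" "distinct [A, B, C, D]"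
      "x = scalar L (cross_ratio L A B C D)" "y = scalar L (cross_ratio L A C B D)"
      unfolding R_def by blast
    have "\<Phi> (scalar L (cross_ratio L A B C D)) = scalar L (cross_ratio L A C B D)"
      using \<Phi> 1(1,2) unfolding P_def by simp
    then have "\<Phi> x = y" using 1(3,4) by simp
    then show "\<Phi> x = \<Psi> x" using \<Psi>[OF y] by simp
  qed
  ultimately have "(THE \<Phi>. P \<Phi>) = \<Psi>" by (rule the_equality)
  then have "cross_ratio_involution L = \<Psi>"
    unfolding cross_ratio_involution_def Let_def P_def S_def by simp
  then show ?thesis using \<Psi>[OF RI[OF assms]] by simp
qed

end

text \<open>
  A frame is a choice of arrows \<open>\<gamma> A\<close> from one point \<open>Q\<close> to every point \<open>A\<close>. It identifies each arrow
  \<open>f : A \<rightarrow> B\<close> with a loop at \<open>Q\<close>, hence with a scalar, and so turns equations between composites of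
  arrows into equations in the commutative group \<open>G\<close>. The scalar of a loop does not depend on the
  frame, so cross ratios and tri-rapports are products of the scalars of their factors.
\<close>

locale framed_projective_line = projective_line_groupoid L
  for L :: "('o, 'a) pgpd" (structure) +
  fixes Q :: 'o and \<gamma> :: "'o \<Rightarrow> 'a"
  assumes Q: "Q \<in> Obj L" and frame: "A \<in> Obj L \<Longrightarrow> \<gamma> A \<in> arrows L Q A"
begin

definition arrow_scalar :: "'a \<Rightarrow> 'a set"
  where "arrow_scalar f = scalar L (\<gamma> (Dom L f) \<Zsemi> f \<Zsemi> inverse_arrow L (\<gamma> (Cod L f)))"

lemma arrow_scalar_eq: "f \<in> arrows L A B \<Longrightarrow> arrow_scalar f = scalar L (\<gamma> A \<Zsemi> f \<Zsemi> inverse_arrow L (\<gamma> B))"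
  using arrowsD[of f A B] by (simp add: arrow_scalar_def)

lemma frames:
  assumes "f \<in> arrows L A B"
  shows "\<gamma> A \<in> arrows L Q A" "inverse_arrow L (\<gamma> A) \<in> arrows L A Q"
    "\<gamma> B \<in> arrows L Q B" "inverse_arrow L (\<gamma> B) \<in> arrows L B Q"
    "\<gamma> A \<Zsemi> f \<in> arrows L Q B" "\<gamma> A \<Zsemi> f \<Zsemi> inverse_arrow L (\<gamma> B) \<in> arrows L Q Q"
proof -
  note AB = arrowsD(4,5)[OF assms]
  show A: "\<gamma> A \<in> arrows L Q A" and B: "\<gamma> B \<in> arrows L Q B" using AB frame by simp_all
  show "inverse_arrow L (\<gamma> A) \<in> arrows L A Q" and B': "inverse_arrow L (\<gamma> B) \<in> arrows L B Q"
    using inverse_arrow(1)[OF A] inverse_arrow(1)[OF B] by simp_all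
  show f: "\<gamma> A \<Zsemi> f \<in> arrows L Q B" by (rule comp_closed[OF A assms])
  show "\<gamma> A \<Zsemi> f \<Zsemi> inverse_arrow L (\<gamma> B) \<in> arrows L Q Q" by (rule comp_closed[OF f B'])
qed

lemma arrow_scalar_closed: "f \<in> arrows L A B \<Longrightarrow> arrow_scalar f \<in> carrier G"
  using scalar_closed[OF frames(6)] by (simp add: arrow_scalar_eq)

lemma arrow_scalar_comp:
  assumes f: "f \<in> arrows L A B" and g: "g \<in> arrows L B C"
  shows "arrow_scalar (f \<Zsemi> g) = arrow_scalar f \<otimes>\<^bsub>G\<^esub> arrow_scalar g"
proof -
  note F = frames[OF f] and G' = frames[OF g]
  have "(\<gamma> A \<Zsemi> f \<Zsemi> inverse_arrow L (\<gamma> B)) \<Zsemi> (\<gamma> B \<Zsemi> g \<Zsemi> inverse_arrow L (\<gamma> C))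
      = \<gamma> A \<Zsemi> f \<Zsemi> (inverse_arrow L (\<gamma> B) \<Zsemi> (\<gamma> B \<Zsemi> (g \<Zsemi> inverse_arrow L (\<gamma> C))))"
    by (simp only: comp_assoc[OF G'(1) g G'(4)]
        comp_assoc[OF F(5) F(4) comp_closed[OF G'(1) comp_closed[OF g G'(4)]]])
  also have "\<dots> = \<gamma> A \<Zsemi> f \<Zsemi> (g \<Zsemi> inverse_arrow L (\<gamma> C))"
    by (simp only: comp_inverse_cancel(2)[OF F(3) comp_closed[OF g G'(4)]])
  also have "\<dots> = \<gamma> A \<Zsemi> (f \<Zsemi> g) \<Zsemi> inverse_arrow L (\<gamma> C)"
    by (simp only: comp_assoc[OF F(5) g G'(4), symmetric] comp_assoc[OF F(1) f g])
  finally show ?thesis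
    using scalar_comp[OF F(6) G'(6)] by (simp add: arrow_scalar_eq[OF f] arrow_scalar_eq[OF g] arrow_scalar_eq[OF comp_closed[OF f g]])
qed

lemma arrow_scalar_loop:
  assumes \<mu>: "\<mu> \<in> arrows L A A"
  shows "arrow_scalar \<mu> = scalar L \<mu>"
proof -
  note F = frames[OF \<mu>]
  have "inverse_arrow L (inverse_arrow L (\<gamma> A)) = \<gamma> A"
    by (rule inverse_arrow_eqI[OF F(2,1) inverse_arrow(3)[OF F(1)]])
  then show ?thesis using scalar_conj[OF \<mu> F(2)] by (simp add: arrow_scalar_eq[OF \<mu>])
qed

lemma arrow_scalar_id: "A \<in> Obj L \<Longrightarrow> arrow_scalar (Idt L A) = \<one>\<^bsub>G\<^esub>"
  using arrow_scalar_loop[OF id_closed] scalar_id by simp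

lemma arrow_scalar_bij:
  assumes A: "A \<in> Obj L" and B: "B \<in> Obj L"
  shows "bij_betw arrow_scalar (arrows L A B) (carrier G)"
proof (rule bij_betw_imageI)
  note a = frame[OF A] inverse_arrow(1)[OF frame[OF A]] and b = frame[OF B] inverse_arrow(1)[OF frame[OF B]]
  have unframe: "inverse_arrow L (\<gamma> A) \<Zsemi> ((\<gamma> A \<Zsemi> f \<Zsemi> inverse_arrow L (\<gamma> B)) \<Zsemi> \<gamma> B) = f"
    if f: "f \<in> arrows L A B" for f
  proof -
    have "\<gamma> A \<Zsemi> f \<Zsemi> inverse_arrow L (\<gamma> B) \<Zsemi> \<gamma> B = \<gamma> A \<Zsemi> f"
      using comp_assoc[OF frames(5)[OF f] b(2,1)] inverse_arrow(3)[OF b(1)] id_right[OF frames(5)[OF f]]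
      by simp
    then show ?thesis using comp_inverse_cancel(2)[OF a(1) f] by simp
  qed
  show "inj_on arrow_scalar (arrows L A B)"
  proof (rule inj_onI)
    fix f g assume f: "f \<in> arrows L A B" and g: "g \<in> arrows L A B" and eq: "arrow_scalar f = arrow_scalar g"
    have "\<gamma> A \<Zsemi> f \<Zsemi> inverse_arrow L (\<gamma> B) = \<gamma> A \<Zsemi> g \<Zsemi> inverse_arrow L (\<gamma> B)"
      using scalar_inj[OF frames(6)[OF f] frames(6)[OF g]] eq by (simp add: arrow_scalar_eq[OF f] arrow_scalar_eq[OF g])
    then show "f = g" using unframe[OF f] unframe[OF g] by metis
  qed
  have "x \<in> arrow_scalar ` arrows L A B" if "x \<in> carrier G" for x
  proof -
    obtain \<mu> where \<mu>: "\<mu> \<in> arrows L Q Q" "x = scalar L \<mu>" using \<open>x \<in> carrier G\<close> Q by (rule scalarE)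
    define f where "f = inverse_arrow L (\<gamma> A) \<Zsemi> (\<mu> \<Zsemi> \<gamma> B)"
    have \<mu>b: "\<mu> \<Zsemi> \<gamma> B \<in> arrows L Q B" by (rule comp_closed[OF \<mu>(1) b(1)])
    have f: "f \<in> arrows L A B" unfolding f_def by (rule comp_closed[OF a(2) \<mu>b])
    have "\<gamma> A \<Zsemi> f = \<mu> \<Zsemi> \<gamma> B" unfolding f_def by (rule comp_inverse_cancel(1)[OF a(1) \<mu>b])
    then have "\<gamma> A \<Zsemi> f \<Zsemi> inverse_arrow L (\<gamma> B) = \<mu>"
      using comp_assoc[OF \<mu>(1) b] inverse_arrow(2)[OF b(1)] id_right[OF \<mu>(1)] by simp
    then show ?thesis using arrow_scalar_eq[OF f] \<mu>(2) f by blast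
  qed
  then show "arrow_scalar ` arrows L A B = carrier G" using arrow_scalar_closed by blast
qed

text \<open>
  The point that names the arrow comes last: \<open>proj_scalar A B C\<close> belongs to \<open>\<langle>C : A \<rightarrow> B\<rangle>\<close>. For the
  lines of \<open>(a, 1)\<close>, \<open>(b, 1)\<close>, \<open>(c, 1)\<close> in the plane, framed by these vectors, it is
  \<open>(a - c) / (b - c)\<close>.
\<close>

definition proj_scalar :: "'o \<Rightarrow> 'o \<Rightarrow> 'o \<Rightarrow> 'a set"
  where "proj_scalar A B C = arrow_scalar \<langle>C : A \<rightarrow> B\<rangle>"

lemma proj_scalar_closed: "\<lbrakk>{A, B, C} \<subseteq> Obj L; distinct [A, B, C]\<rbrakk> \<Longrightarrow> proj_scalar A B C \<in> carrier G"
  unfolding proj_scalar_def by (rule arrow_scalar_closed[OF proj_arrow])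

lemma proj_scalar_bij:
  assumes "A \<in> Obj L" "B \<in> Obj L" "A \<noteq> B"
  shows "bij_betw (proj_scalar A B) (Obj L - {A, B}) (carrier G)"
proof -
  have "proj_scalar A B = arrow_scalar \<circ> (\<lambda>C. \<langle>C : A \<rightarrow> B\<rangle>)" by (auto simp: proj_scalar_def)
  then show ?thesis using bij_betw_trans[OF proj_bij[OF assms] arrow_scalar_bij[OF assms(1,2)]] by simp
qed

lemma proj_scalar_inverse:
  assumes X: "{A, B, C} \<subseteq> Obj L" "distinct [A, B, C]"
  shows "proj_scalar A B C \<otimes>\<^bsub>G\<^esub> proj_scalar B A C = \<one>\<^bsub>G\<^esub>"
proof -
  have X': "{B, A, C} \<subseteq> Obj L" "distinct [B, A, C]" and A: "A \<in> Obj L" using X by auto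
  show ?thesis
    using arrow_scalar_comp[OF proj_arrow[OF X] proj_arrow[OF X']] arrow_scalar_id[OF A] axiom1_inverse[OF X] by (simp add: proj_scalar_def)
qed

lemma proj_scalar_trans:
  assumes X: "{A, B, C, D} \<subseteq> Obj L" "distinct [A, B, C, D]"
  shows "proj_scalar A B C \<otimes>\<^bsub>G\<^esub> proj_scalar B D C = proj_scalar A D C"
proof -
  have a: "\<langle>C : A \<rightarrow> B\<rangle> \<in> arrows L A B" "\<langle>C : B \<rightarrow> D\<rangle> \<in> arrows L B D"
    using X by (auto intro!: proj_arrow)
  show ?thesis using arrow_scalar_comp[OF a] axiom1_trans[OF X] by (simp add: proj_scalar_def)
qed

lemma scalar_cross_ratio:
  assumes X: "{A, B, C, D} \<subseteq> Obj L" "distinct [A, B, C, D]"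
  shows "scalar L (cross_ratio L A B C D) = proj_scalar A B C \<otimes>\<^bsub>G\<^esub> proj_scalar B A D"
proof -
  have a: "\<langle>C : A \<rightarrow> B\<rangle> \<in> arrows L A B" "\<langle>D : B \<rightarrow> A\<rangle> \<in> arrows L B A"
    using X by (auto intro!: proj_arrow)
  show ?thesis using arrow_scalar_comp[OF a] arrow_scalar_loop[OF comp_closed[OF a]] by (simp add: proj_scalar_def cross_ratio_def)
qed

lemma scalar_tri_rapport:
  assumes X: "{A, B, C} \<subseteq> Obj L" "distinct [A, B, C]"
  shows "scalar L (tri_rapport L A B C C A B) = proj_scalar A B C \<otimes>\<^bsub>G\<^esub> proj_scalar B C A \<otimes>\<^bsub>G\<^esub> proj_scalar C A B"
proof -
  have a: "\<langle>C : A \<rightarrow> B\<rangle> \<in> arrows L A B" "\<langle>A : B \<rightarrow> C\<rangle> \<in> arrows L B C" "\<langle>B : C \<rightarrow> A\<rangle> \<in> arrows L C A"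
    using X by (auto intro!: proj_arrow)
  note ab = comp_closed[OF a(1,2)]
  show ?thesis
    using arrow_scalar_comp[OF a(1,2)] arrow_scalar_comp[OF ab a(3)] arrow_scalar_loop[OF comp_closed[OF ab a(3)]]
    by (simp add: proj_scalar_def tri_rapport_def)
qed

end

section \<open>The scalar minus one and the addition of scalars\<close>

context framed_projective_line
begin

text \<open>
  The tri-rapport \<open>(A, B, C; C, A, B)\<close> as a scalar.
\<close>

definition triple :: "'o \<Rightarrow> 'o \<Rightarrow> 'o \<Rightarrow> 'a set"
  where "triple A B C = proj_scalar A B C \<otimes>\<^bsub>G\<^esub> proj_scalar B C A \<otimes>\<^bsub>G\<^esub> proj_scalar C A B"

lemma triple_closed:
  assumes "{A, B, C} \<subseteq> Obj L" "distinct [A, B, C]"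
  shows "triple A B C \<in> carrier G"
  unfolding triple_def using assms by (intro G.m_closed proj_scalar_closed) auto

lemma triple_rotate:
  assumes "{A, B, C} \<subseteq> Obj L" "distinct [A, B, C]"
  shows "triple B C A = triple A B C"
proof -
  have "proj_scalar A B C \<in> carrier G" "proj_scalar B C A \<in> carrier G" "proj_scalar C A B \<in> carrier G"
    using assms by (auto intro!: proj_scalar_closed)
  then show ?thesis unfolding triple_def by (simp add: G.m_ac)
qed

lemma triple_reverse:
  assumes "{A, B, C} \<subseteq> Obj L" "distinct [A, B, C]"
  shows "triple A B C \<otimes>\<^bsub>G\<^esub> triple A C B = \<one>\<^bsub>G\<^esub>"
proof -
  have c: "proj_scalar A B C \<in> carrier G" "proj_scalar B C A \<in> carrier G" "proj_scalar C A B \<in> carrier G"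
    "proj_scalar B A C \<in> carrier G" "proj_scalar C B A \<in> carrier G" "proj_scalar A C B \<in> carrier G"
    using assms by (auto intro!: proj_scalar_closed)
  have "triple A B C \<otimes>\<^bsub>G\<^esub> triple A C B =
      (proj_scalar A B C \<otimes>\<^bsub>G\<^esub> proj_scalar B A C) \<otimes>\<^bsub>G\<^esub> ((proj_scalar B C A \<otimes>\<^bsub>G\<^esub> proj_scalar C B A) \<otimes>\<^bsub>G\<^esub> (proj_scalar C A B \<otimes>\<^bsub>G\<^esub> proj_scalar A C B))"
    unfolding triple_def using c by (simp add: G.m_ac)
  also have "\<dots> = \<one>\<^bsub>G\<^esub>" using assms proj_scalar_inverse[of A B C] proj_scalar_inverse[of B C A] proj_scalar_inverse[of C A B] by auto
  finally show ?thesis .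
qed

lemma triple_replace:
  assumes "{A, B, C, D} \<subseteq> Obj L" "distinct [A, B, C]" "distinct [A, B, D]"
  shows "triple A B C = triple A B D"
proof (cases "C = D")
  case False
  then have X: "{A, B, C, D} \<subseteq> Obj L" "distinct [A, B, C, D]" using assms by auto
  then show ?thesis
    using axiom4[OF X] scalar_tri_rapport[of A B C] scalar_tri_rapport[of A B D]
    by (simp add: triple_def)
qed simp

text \<open>
  Axiom 4 allows the last point to be replaced by a fourth one, and rotation brings any point to the
  last position. Three replacements that use \<open>D\<close> as a spare place interchange \<open>B\<close> and \<open>C\<close>. Since
  interchanging them also inverts the scalar, its square is \<open>1\<close>.
\<close>

lemma triple_swap:
  assumes X: "{A, B, C} \<subseteq> Obj L" "distinct [A, B, C]"
    and D: "D \<in> Obj L" "D \<noteq> A" "D \<noteq> B" "D \<noteq> C"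
  shows "triple A C B = triple A B C"
proof -
  have "triple A B C = triple A B D" using X D by (intro triple_replace) auto
  also have "\<dots> = triple D A B" using X D triple_rotate[of D A B] by simp
  also have "\<dots> = triple D A C" using X D by (intro triple_replace) auto
  also have "\<dots> = triple A C D" using X D triple_rotate[of D A C] by simp
  also have "\<dots> = triple A C B" using X D by (intro triple_replace) auto
  finally show ?thesis by simp
qed

end

locale framed_projective_line_four_points = framed_projective_line L Q \<gamma>
  for L :: "('o, 'a) pgpd" (structure) and Q \<gamma> +
  assumes fourth_point: "\<lbrakk>A \<in> Obj L; B \<in> Obj L; C \<in> Obj L\<rbrakk> \<Longrightarrow> \<exists>D \<in> Obj L. D \<notin> {A, B, C}"
begin

text \<open>
  The value depends only on the set of points, by rotation and interchange, and it does not change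
  when one of them is replaced; any triple is reached from any other by such replacements.
\<close>

lemma triple_unique:
  assumes X: "{A, B, C} \<subseteq> Obj L" "distinct [A, B, C]"
    and X': "{A', B', C'} \<subseteq> Obj L" "distinct [A', B', C']"
  shows "triple A B C = triple A' B' C'"
proof -
  have sym: "triple U V W = triple V U W'"
    if *: "{U, V, W, W'} \<subseteq> Obj L" "distinct [U, V, W]" "distinct [U, V, W']" for U V W W'
  proof -
    obtain D where "D \<in> Obj L" "D \<notin> {U, V, W}" using fourth_point[of U V W] *(1) by auto
    then have "triple U W V = triple U V W" using * by (intro triple_swap[of _ _ _ D]) auto
    moreover have "triple U W V = triple V U W" using * triple_rotate[of V U W] by auto
    moreover have "triple V U W = triple V U W'" using * by (intro triple_replace) auto
    ultimately show ?thesis by simp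
  qed
  have move: "triple U V W = triple U V' W'"
    if *: "{U, V, W, V', W'} \<subseteq> Obj L" "distinct [U, V, W]" "distinct [U, V', W']" for U V W V' W'
  proof (cases "V' = V")
    case True
    then show ?thesis using triple_replace[of U V W W'] * by auto
  next
    case False
    have "triple U V W = triple U V V'" using * False by (intro triple_replace) auto
    also have "\<dots> = triple V' U V" using * False triple_rotate[of V' U V] by auto
    also have "\<dots> = triple U V' W'" using * False by (intro sym) auto
    finally show ?thesis .
  qed
  show ?thesis
  proof (cases "A' = A")
    case True
    then show ?thesis using move[of A B C B' C'] X X' by auto
  next
    case False
    obtain D where D: "D \<in> Obj L" "D \<noteq> A" "D \<noteq> A'" using extra_point[of A A'] X(1) X'(1) by auto
    have "triple A B C = triple A A' D" using X X' D False by (intro move) auto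
    also have "\<dots> = triple A' A D" using X X' D False by (intro sym) auto
    also have "\<dots> = triple A' B' C'" using X X' D False by (intro move) auto
    finally show ?thesis .
  qed
qed

lemma scalar_minus_one_eq:
  assumes "{A, B, C} \<subseteq> Obj L" "distinct [A, B, C]"
  shows "scalar_minus_one L = triple A B C"
  unfolding scalar_minus_one_def
proof (rule the_equality)
  show "triple A B C \<in> carrier G \<and> (\<forall>A' B' C'. {A', B', C'} \<subseteq> Obj L \<and> distinct [A', B', C'] \<longrightarrow>
      scalar L (tri_rapport L A' B' C' C' A' B') = triple A B C)"
  proof (intro conjI allI impI)
    fix A' B' C' assume *: "{A', B', C'} \<subseteq> Obj L \<and> distinct [A', B', C']"
    then have "scalar L (tri_rapport L A' B' C' C' A' B') = triple A' B' C'"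
      unfolding triple_def by (intro scalar_tri_rapport) auto
    also have "\<dots> = triple A B C" using * assms by (intro triple_unique) auto
    finally show "scalar L (tri_rapport L A' B' C' C' A' B') = triple A B C" .
  qed (rule triple_closed[OF assms])
next
  fix e assume "e \<in> carrier G \<and> (\<forall>A B C. {A, B, C} \<subseteq> Obj L \<and> distinct [A, B, C] \<longrightarrow>
      scalar L (tri_rapport L A B C C A B) = e)"
  then show "e = triple A B C"
    using assms scalar_tri_rapport[OF assms] unfolding triple_def by metis
qed

abbreviation e where "e \<equiv> scalar_minus_one L"

lemma minus_one: "e \<in> carrier G" "e \<otimes>\<^bsub>G\<^esub> e = \<one>\<^bsub>G\<^esub>"
proof -
  obtain B where B: "B \<in> Obj L" "B \<noteq> Q" using extra_point[OF Q Q] by metis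
  obtain C where C: "C \<in> Obj L" "C \<noteq> Q" "C \<noteq> B" using extra_point[OF Q B(1)] by metis
  have X: "{Q, B, C} \<subseteq> Obj L" "distinct [Q, B, C]" and Y: "{Q, C, B} \<subseteq> Obj L" "distinct [Q, C, B]"
    using Q B C by auto
  show "e \<in> carrier G" using triple_closed[OF X] scalar_minus_one_eq[OF X] by simp
  show "e \<otimes>\<^bsub>G\<^esub> e = \<one>\<^bsub>G\<^esub>"
    using triple_reverse[OF X] scalar_minus_one_eq[OF X] scalar_minus_one_eq[OF Y] by simp
qed

abbreviation K where "K \<equiv> scalar_field L"

sublocale K: field K
  by (rule scalars_field)

lemma K_simps:
  "carrier K - {\<zero>\<^bsub>K\<^esub>} = Some ` carrier G" "\<zero>\<^bsub>K\<^esub> = None" "\<one>\<^bsub>K\<^esub> = Some \<one>\<^bsub>G\<^esub>"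
  "Some x \<otimes>\<^bsub>K\<^esub> Some y = Some (x \<otimes>\<^bsub>G\<^esub> y)"
  by (auto simp: scalar_field_def scalar_mult_def)

text \<open>
  With \<open>e = -1\<close> and \<open>e e = 1\<close>, the argument of the involution in the definition of the sum
  \<open>1 + e x\<close> is \<open>x\<close> itself.
\<close>

lemma K_add_one:
  assumes "x \<in> carrier G"
  shows "\<one>\<^bsub>K\<^esub> \<oplus>\<^bsub>K\<^esub> Some (e \<otimes>\<^bsub>G\<^esub> x) =
    (if x = \<one>\<^bsub>G\<^esub> then None else Some (\<one>\<^bsub>G\<^esub> \<otimes>\<^bsub>G\<^esub> cross_ratio_involution L x))"
proof -
  have "e \<otimes>\<^bsub>G\<^esub> inv\<^bsub>G\<^esub> \<one>\<^bsub>G\<^esub> \<otimes>\<^bsub>G\<^esub> (e \<otimes>\<^bsub>G\<^esub> x) = x"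
    using assms minus_one by (simp flip: G.m_assoc)
  then show ?thesis by (simp add: scalar_field_def scalar_add_def)
qed

lemma K_minus_one: "\<ominus>\<^bsub>K\<^esub> \<one>\<^bsub>K\<^esub> = Some e"
proof -
  have c: "Some e \<in> carrier K" using K_simps(1) minus_one(1) by blast
  have "\<one>\<^bsub>K\<^esub> \<oplus>\<^bsub>K\<^esub> Some e = \<zero>\<^bsub>K\<^esub>"
    using K_add_one[OF G.one_closed] minus_one(1) by (simp add: K_simps(2))
  then have "Some e \<oplus>\<^bsub>K\<^esub> \<one>\<^bsub>K\<^esub> = \<zero>\<^bsub>K\<^esub>" using c by (simp add: K.a_comm)
  then show ?thesis using c by (intro K.minus_equality) auto
qed

text \<open>
  The addition of the scalar field is made so that the involution is \<open>\<lambda> \<mapsto> 1 - \<lambda>\<close>: interchanging the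
  two middle points changes a cross ratio exactly as it does in the plane.
\<close>

lemma K_involution:
  assumes X: "{A, B, C, D} \<subseteq> Obj L" "distinct [A, B, C, D]"
  shows "Some (scalar L (cross_ratio L A C B D)) = \<one>\<^bsub>K\<^esub> \<ominus>\<^bsub>K\<^esub> Some (scalar L (cross_ratio L A B C D))"
proof -
  let ?x = "scalar L (cross_ratio L A B C D)"
  have x: "?x \<in> carrier G" "?x \<noteq> \<one>\<^bsub>G\<^esub>"
    using scalar_closed[OF cross_ratio_loop[OF X]] cross_ratio_nontrivial[OF X] by auto
  have "{A, C, B, D} \<subseteq> Obj L" "distinct [A, C, B, D]" using X by auto
  then have y: "scalar L (cross_ratio L A C B D) \<in> carrier G"
    by (rule scalar_closed[OF cross_ratio_loop])
  have c: "Some ?x \<in> carrier K" using K_simps(1) x(1) by blast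
  have "\<ominus>\<^bsub>K\<^esub> Some ?x = (\<ominus>\<^bsub>K\<^esub> \<one>\<^bsub>K\<^esub>) \<otimes>\<^bsub>K\<^esub> Some ?x" using c by (simp add: K.l_minus)
  also have "\<dots> = Some (e \<otimes>\<^bsub>G\<^esub> ?x)" by (simp only: K_minus_one K_simps(4))
  finally have "\<one>\<^bsub>K\<^esub> \<ominus>\<^bsub>K\<^esub> Some ?x = Some (cross_ratio_involution L ?x)"
    using K_add_one[OF x(1)] x(2) y cross_ratio_involution_apply[OF X] by (simp add: K.minus_eq)
  then show ?thesis using cross_ratio_involution_apply[OF X] by simp
qed

end

section \<open>Lines of a coordinate plane and isomorphisms between them\<close>

lemma (in vectorspace) span_singleton:
  assumes "u \<in> carrier V"
  shows "span {u} = (\<lambda>c. c \<odot>\<^bsub>V\<^esub> u) ` carrier K"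
proof -
  have comb: "lincomb a {u} = a u \<odot>\<^bsub>V\<^esub> u" if "a \<in> {u} \<rightarrow> carrier K" for a
    using that assms unfolding lincomb_def by simp
  have "span {u} = {lincomb a {u} | a. a \<in> {u} \<rightarrow> carrier K}"
    using assms by (intro finite_span) auto
  also have "\<dots> = (\<lambda>c. c \<odot>\<^bsub>V\<^esub> u) ` carrier K"
  proof safe
    fix a assume a: "a \<in> {u} \<rightarrow> carrier K"
    show "lincomb a {u} \<in> (\<lambda>c. c \<odot>\<^bsub>V\<^esub> u) ` carrier K"
      using comb[OF a] a by auto
  next
    fix c assume c: "c \<in> carrier K"
    then show "\<exists>a. c \<odot>\<^bsub>V\<^esub> u = lincomb a {u} \<and> a \<in> {u} \<rightarrow> carrier K"
      using comb[of "\<lambda>_. c"] by (intro exI[of _ "\<lambda>_. c"]) auto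
  qed
  finally show ?thesis .
qed

lemma (in vectorspace) smult_eq_zero_iff:
  assumes "c \<in> carrier K" "u \<in> carrier V" "u \<noteq> \<zero>\<^bsub>V\<^esub>"
  shows "c \<odot>\<^bsub>V\<^esub> u = \<zero>\<^bsub>V\<^esub> \<longleftrightarrow> c = \<zero>\<^bsub>K\<^esub>"
proof
  assume 0: "c \<odot>\<^bsub>V\<^esub> u = \<zero>\<^bsub>V\<^esub>"
  show "c = \<zero>\<^bsub>K\<^esub>"
  proof (rule ccontr)
    assume c: "c \<noteq> \<zero>\<^bsub>K\<^esub>"
    then have "u = inv\<^bsub>K\<^esub> c \<odot>\<^bsub>V\<^esub> \<zero>\<^bsub>V\<^esub>"
      using mult_inverse[OF assms(1,2) 0] by simp
    then show False using assms c by (simp add: field_Units)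
  qed
qed (use assms in simp)

text \<open>
  The generating vector is the element of a one-element basis; conversely a nonzero vector is
  linearly independent, so that a generating one is a basis.
\<close>

lemma (in vectorspace) one_dimensional_iff:
  "fin_dim \<and> dim = 1 \<longleftrightarrow>
    (\<exists>u \<in> carrier V. u \<noteq> \<zero>\<^bsub>V\<^esub> \<and> carrier V = (\<lambda>c. c \<odot>\<^bsub>V\<^esub> u) ` carrier K)"
proof
  assume *: "fin_dim \<and> dim = 1"
  then obtain B where B: "finite B" "basis B" using finite_basis_exists by blast
  with * dim_basis have "card B = 1" by simp
  then obtain u where u: "B = {u}" by (auto simp: card_1_singleton_iff)
  with B have "u \<in> carrier V" "u \<noteq> \<zero>\<^bsub>V\<^esub>" "span {u} = carrier V"
    using vs_zero_lin_dep[of B] unfolding basis_def by auto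
  then show "\<exists>u \<in> carrier V. u \<noteq> \<zero>\<^bsub>V\<^esub> \<and> carrier V = (\<lambda>c. c \<odot>\<^bsub>V\<^esub> u) ` carrier K"
    using span_singleton by metis
next
  assume "\<exists>u \<in> carrier V. u \<noteq> \<zero>\<^bsub>V\<^esub> \<and> carrier V = (\<lambda>c. c \<odot>\<^bsub>V\<^esub> u) ` carrier K"
  then obtain u where u: "u \<in> carrier V" "u \<noteq> \<zero>\<^bsub>V\<^esub>" "span {u} = carrier V"
    using span_singleton by metis
  have "lin_indpt {u}"
  proof
    assume "lin_dep {u}"
    then obtain a where a: "a \<in> {u} \<rightarrow> carrier K" "lincomb a {u} = \<zero>\<^bsub>V\<^esub>" "a u \<noteq> \<zero>\<^bsub>K\<^esub>"
      using finite_lin_dep[of "{u}"] u by auto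
    then have "a u \<odot>\<^bsub>V\<^esub> u = \<zero>\<^bsub>V\<^esub>"
      using u unfolding lincomb_def by simp
    then show False using smult_eq_zero_iff a u by auto
  qed
  then have "basis {u}" using u unfolding basis_def by simp
  then show "fin_dim \<and> dim = 1"
    using dim_basis[of "{u}"] u unfolding fin_dim_def by (auto intro!: exI[of _ "{u}"])
qed

lemma coordinate_plane_simps:
  "carrier (coordinate_plane K) = carrier K \<times> carrier K"
  "\<zero>\<^bsub>coordinate_plane K\<^esub> = (\<zero>\<^bsub>K\<^esub>, \<zero>\<^bsub>K\<^esub>)"
  "(a, b) \<oplus>\<^bsub>coordinate_plane K\<^esub> (c, d) = (a \<oplus>\<^bsub>K\<^esub> c, b \<oplus>\<^bsub>K\<^esub> d)"
  "s \<odot>\<^bsub>coordinate_plane K\<^esub> (a, b) = (s \<otimes>\<^bsub>K\<^esub> a, s \<otimes>\<^bsub>K\<^esub> b)"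
  by (simp_all add: coordinate_plane_def coordinate_line_def direct_sum_def)

lemma subspace_module_simps:
  "carrier (subspace_module K A) = A"
  "\<zero>\<^bsub>subspace_module K A\<^esub> = \<zero>\<^bsub>coordinate_plane K\<^esub>"
  "add (subspace_module K A) = add (coordinate_plane K)"
  "smult (subspace_module K A) = smult (coordinate_plane K)"
  by (simp_all add: subspace_module_def)

definition line_through :: "'k ring \<Rightarrow> 'k \<times> 'k \<Rightarrow> ('k \<times> 'k) set"
  where "line_through K u = (\<lambda>c. c \<odot>\<^bsub>coordinate_plane K\<^esub> u) ` carrier K"

definition nonzero_vectors :: "'k ring \<Rightarrow> ('k \<times> 'k) set"
  where "nonzero_vectors K = carrier (coordinate_plane K) - {\<zero>\<^bsub>coordinate_plane K\<^esub>}"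

text \<open>
  The determinant of two vectors of the plane: it vanishes exactly when they are linearly dependent, which
  is how membership in a line is tested below.
\<close>

definition bracket :: "'k ring \<Rightarrow> 'k \<times> 'k \<Rightarrow> 'k \<times> 'k \<Rightarrow> 'k"
  where "bracket K u v = fst u \<otimes>\<^bsub>K\<^esub> snd v \<ominus>\<^bsub>K\<^esub> snd u \<otimes>\<^bsub>K\<^esub> fst v"

text \<open>
  Meaningful only when \<open>u\<close> is nonzero and \<open>x\<close> lies on the line through \<open>u\<close>.
\<close>

definition coefficient :: "'k ring \<Rightarrow> 'k \<times> 'k \<Rightarrow> 'k \<times> 'k \<Rightarrow> 'k"
  where "coefficient K u x = (THE c. c \<in> carrier K \<and> x = c \<odot>\<^bsub>coordinate_plane K\<^esub> u)"

text \<open>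
  Once spanning vectors \<open>u\<close> and \<open>v\<close> of two lines are chosen, an isomorphism between the lines is
  determined by the scalar \<open>t\<close> such that \<open>u\<close> is sent to \<open>t v\<close>; this is that isomorphism.
\<close>

definition scaling_arrow ::
  "'k ring \<Rightarrow> 'k \<times> 'k \<Rightarrow> 'k \<times> 'k \<Rightarrow> 'k \<Rightarrow>
    ('k \<times> 'k) set \<times> ('k \<times> 'k) set \<times> ('k \<times> 'k \<Rightarrow> 'k \<times> 'k)"
  where "scaling_arrow K u v t = (line_through K u, line_through K v,
    \<lambda>x \<in> line_through K u. (coefficient K u x \<otimes>\<^bsub>K\<^esub> t) \<odot>\<^bsub>coordinate_plane K\<^esub> v)"

text \<open>
  A field whose structure is called \<open>K\<close>, so that the bare operations below are those of the scalars.
\<close>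

locale scalar_plane = field K for K :: "'k ring" (structure)
begin

abbreviation plane where "plane \<equiv> coordinate_plane K"

lemma coordinate_line_vectorspace: "vectorspace K (coordinate_line K)"
proof -
  have "abelian_group (coordinate_line K)"
    by (rule abelian_groupI)
       (auto simp: coordinate_line_def a_ac intro: l_neg)
  then have "module K (coordinate_line K)"
    by (intro moduleI) (auto simp: coordinate_line_def is_cring l_distr r_distr m_assoc)
  then show ?thesis unfolding vectorspace_def using field_axioms by blast
qed

sublocale P: vectorspace K plane
  unfolding coordinate_plane_def
  by (intro direct_sum_is_vs coordinate_line_vectorspace)

lemmas plane_simps = coordinate_plane_simps[of K]

lemma nonzero_vectorsD:
  assumes "u \<in> nonzero_vectors K"
  shows "u \<in> carrier plane" "u \<noteq> \<zero>\<^bsub>plane\<^esub>"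
  using assms by (auto simp: nonzero_vectors_def)

lemma line_through_eq_span: "u \<in> carrier plane \<Longrightarrow> line_through K u = P.span {u}"
  by (simp add: line_through_def P.span_singleton)

lemma line_through_subspace: "u \<in> carrier plane \<Longrightarrow> subspace K (line_through K u) plane"
  by (subst line_through_eq_span, simp) (intro P.span_is_subspace, simp)

lemma subspace_vectorspace: "subspace K A plane \<Longrightarrow> vectorspace K (subspace_module K A)"
  unfolding subspace_module_def by (rule P.subspace_is_vs)

lemma plane_lines_eq: "plane_lines K = line_through K ` nonzero_vectors K"
proof -
  have one_dim: "vectorspace.fin_dim K (subspace_module K A) \<and>
      vectorspace.dim K (subspace_module K A) = 1 \<longleftrightarrow>
      (\<exists>u \<in> A. u \<noteq> \<zero>\<^bsub>plane\<^esub> \<and> A = line_through K u)"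
    if "subspace K A plane" for A
    using vectorspace.one_dimensional_iff[OF subspace_vectorspace[OF that]]
    by (simp add: subspace_module_simps line_through_def)
  have sub: "A \<subseteq> carrier plane" if "subspace K A plane" for A
    using that by (meson P.is_module submodule.subset)
  have self: "u \<in> line_through K u" if "u \<in> carrier plane" for u
    using P.in_own_span[of "{u}"] that line_through_eq_span by auto
  show ?thesis
  proof (intro equalityI subsetI)
    fix A assume "A \<in> plane_lines K"
    then have "subspace K A plane" "\<exists>u \<in> A. u \<noteq> \<zero>\<^bsub>plane\<^esub> \<and> A = line_through K u"
      using one_dim by (auto simp: plane_lines_def)
    then show "A \<in> line_through K ` nonzero_vectors K"
      using sub unfolding nonzero_vectors_def by blast
  next
    fix A assume "A \<in> line_through K ` nonzero_vectors K"
    then obtain u where u: "u \<in> nonzero_vectors K" "A = line_through K u" by blast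
    then have "subspace K A plane" "\<exists>u \<in> A. u \<noteq> \<zero>\<^bsub>plane\<^esub> \<and> A = line_through K u"
      using nonzero_vectorsD[OF u(1)] line_through_subspace self by blast+
    then show "A \<in> plane_lines K"
      using one_dim by (simp add: plane_lines_def)
  qed
qed

lemma smult_eq_iff:
  assumes "u \<in> nonzero_vectors K" "s \<in> carrier K" "t \<in> carrier K"
  shows "s \<odot>\<^bsub>plane\<^esub> u = t \<odot>\<^bsub>plane\<^esub> u \<longleftrightarrow> s = t"
proof
  note u = nonzero_vectorsD[OF assms(1)]
  assume eq: "s \<odot>\<^bsub>plane\<^esub> u = t \<odot>\<^bsub>plane\<^esub> u"
  have "(s \<ominus> t) \<odot>\<^bsub>plane\<^esub> u = s \<odot>\<^bsub>plane\<^esub> u \<ominus>\<^bsub>plane\<^esub> t \<odot>\<^bsub>plane\<^esub> u"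
    using assms u by (simp add: minus_eq P.smult_l_distr P.smult_l_minus P.M.minus_eq)
  also have "\<dots> = \<zero>\<^bsub>plane\<^esub>"
    unfolding eq using assms(3) u(1) by (simp add: P.M.r_neg P.M.minus_eq)
  finally show "s = t"
    using P.smult_eq_zero_iff[of "s \<ominus> t" u] u assms(2,3) by simp
qed simp

lemma coefficient_smult:
  assumes "u \<in> nonzero_vectors K" "c \<in> carrier K"
  shows "coefficient K u (c \<odot>\<^bsub>plane\<^esub> u) = c"
  unfolding coefficient_def
  using assms smult_eq_iff[OF assms(1)] by (intro the_equality) metis+

lemma line_throughI: "c \<in> carrier K \<Longrightarrow> c \<odot>\<^bsub>plane\<^esub> u \<in> line_through K u"
  by (simp add: line_through_def)

lemma line_throughE:
  assumes "x \<in> line_through K u"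
  obtains c where "c \<in> carrier K" "x = c \<odot>\<^bsub>plane\<^esub> u"
  using assms unfolding line_through_def by blast

lemma scaling_arrow_apply:
  assumes "u \<in> nonzero_vectors K" "c \<in> carrier K"
  shows "snd (snd (scaling_arrow K u v t)) (c \<odot>\<^bsub>plane\<^esub> u) = (c \<otimes> t) \<odot>\<^bsub>plane\<^esub> v"
  using assms by (simp add: scaling_arrow_def coefficient_smult line_throughI)

lemma plane_arrows_iff:
  "(A', B', f) \<in> arrows (plane_groupoid K) A B \<longleftrightarrow> A' = A \<and> B' = B \<and>
    A \<in> plane_lines K \<and> B \<in> plane_lines K \<and> f \<in> extensional A \<and>
    linear_map K (subspace_module K A) (subspace_module K B) f \<and> bij_betw f A B"
  by (auto simp: arrows_def plane_groupoid_def)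

lemma linear_map_iff:
  assumes "subspace K A plane" "subspace K B plane"
  shows "linear_map K (subspace_module K A) (subspace_module K B) f \<longleftrightarrow> f \<in> A \<rightarrow> B \<and>
    (\<forall>x \<in> A. \<forall>y \<in> A. f (x \<oplus>\<^bsub>plane\<^esub> y) = f x \<oplus>\<^bsub>plane\<^esub> f y) \<and>
    (\<forall>c \<in> carrier K. \<forall>x \<in> A. f (c \<odot>\<^bsub>plane\<^esub> x) = c \<odot>\<^bsub>plane\<^esub> f x)"
  using assms[THEN subspace_vectorspace]
  unfolding linear_map_def mod_hom_def mod_hom_axioms_def module_hom_def vectorspace_def
  by (auto simp: subspace_module_simps)

lemma scaling_arrow_in_arrows:
  assumes u: "u \<in> nonzero_vectors K" and v: "v \<in> nonzero_vectors K"
    and t: "t \<in> carrier K" "t \<noteq> \<zero>"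
  shows "scaling_arrow K u v t \<in> arrows (plane_groupoid K) (line_through K u) (line_through K v)"
proof -
  define f where "f = snd (snd (scaling_arrow K u v t))"
  have arrow: "scaling_arrow K u v t = (line_through K u, line_through K v, f)"
    by (simp add: f_def scaling_arrow_def)
  have f: "f (c \<odot>\<^bsub>plane\<^esub> u) = (c \<otimes> t) \<odot>\<^bsub>plane\<^esub> v" if "c \<in> carrier K" for c
    using that u by (simp only: f_def scaling_arrow_apply)
  note uP = nonzero_vectorsD(1)[OF u] and vP = nonzero_vectorsD(1)[OF v]
  have linear: "linear_map K (subspace_module K (line_through K u))
      (subspace_module K (line_through K v)) f"
  proof (subst linear_map_iff[OF line_through_subspace[OF uP] line_through_subspace[OF vP]],
      intro conjI ballI)
    show "f \<in> line_through K u \<rightarrow> line_through K v"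
      using f t by (auto elim!: line_throughE intro!: line_throughI)
  next
    fix x y assume "x \<in> line_through K u" "y \<in> line_through K u"
    then obtain c d where cd: "c \<in> carrier K" "x = c \<odot>\<^bsub>plane\<^esub> u" "d \<in> carrier K" "y = d \<odot>\<^bsub>plane\<^esub> u"
      by (meson line_throughE)
    then have "x \<oplus>\<^bsub>plane\<^esub> y = (c \<oplus> d) \<odot>\<^bsub>plane\<^esub> u"
      using uP by (simp add: P.smult_l_distr)
    then show "f (x \<oplus>\<^bsub>plane\<^esub> y) = f x \<oplus>\<^bsub>plane\<^esub> f y"
      using cd f t vP by (simp add: P.smult_l_distr l_distr)
  next
    fix c x assume "c \<in> carrier K" "x \<in> line_through K u"
    moreover then obtain d where "d \<in> carrier K" "x = d \<odot>\<^bsub>plane\<^esub> u"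
      by (meson line_throughE)
    ultimately show "f (c \<odot>\<^bsub>plane\<^esub> x) = c \<odot>\<^bsub>plane\<^esub> f x"
      using f t uP vP
      by (simp add: P.smult_assoc1[symmetric] m_assoc[symmetric])
  qed
  have bij: "bij_betw f (line_through K u) (line_through K v)"
  proof (rule bij_betw_imageI)
    show "inj_on f (line_through K u)"
    proof (rule inj_onI)
      fix x y assume "x \<in> line_through K u" "y \<in> line_through K u" and eq: "f x = f y"
      then obtain c d where cd: "c \<in> carrier K" "x = c \<odot>\<^bsub>plane\<^esub> u" "d \<in> carrier K" "y = d \<odot>\<^bsub>plane\<^esub> u"
        by (meson line_throughE)
      with eq f t v have "c \<otimes> t = d \<otimes> t" by (simp add: smult_eq_iff)
      with cd t show "x = y" by (simp add: m_rcancel)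
    qed
  next
    have "\<exists>x \<in> line_through K u. f x = y" if y: "y \<in> line_through K v" for y
    proof -
      obtain d where d: "d \<in> carrier K" "y = d \<odot>\<^bsub>plane\<^esub> v" using y by (meson line_throughE)
      have i: "inv t \<in> carrier K" "inv t \<otimes> t = \<one>" using t by (auto simp: field_Units)
      have "f ((d \<otimes> inv t) \<odot>\<^bsub>plane\<^esub> u) = y"
        using d i t f by (simp add: m_assoc)
      then show ?thesis using d i line_throughI[of "d \<otimes> inv t" u] by blast
    qed
    moreover have "f \<in> line_through K u \<rightarrow> line_through K v"
      using f t by (auto elim!: line_throughE intro!: line_throughI)
    ultimately show "f ` line_through K u = line_through K v" by blast
  qed
  have "f \<in> extensional (line_through K u)"
    by (simp add: f_def scaling_arrow_def)
  then show ?thesis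
    unfolding arrow plane_arrows_iff plane_lines_eq using u v linear bij by blast
qed

lemma scaling_arrow_surj:
  assumes u: "u \<in> nonzero_vectors K" and v: "v \<in> nonzero_vectors K"
    and h: "h \<in> arrows (plane_groupoid K) (line_through K u) (line_through K v)"
  shows "\<exists>t \<in> carrier K - {\<zero>}. h = scaling_arrow K u v t"
proof -
  note uP = nonzero_vectorsD[OF u] and vP = nonzero_vectorsD[OF v]
  obtain f where hf: "h = (line_through K u, line_through K v, f)"
    using h by (cases h) (auto simp: plane_arrows_iff)
  with h have ext: "f \<in> extensional (line_through K u)"
    and bij: "bij_betw f (line_through K u) (line_through K v)"
    and lin: "linear_map K (subspace_module K (line_through K u))
      (subspace_module K (line_through K v)) f"
    by (auto simp: plane_arrows_iff)
  have smult: "f (c \<odot>\<^bsub>plane\<^esub> x) = c \<odot>\<^bsub>plane\<^esub> f x"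
    if "c \<in> carrier K" "x \<in> line_through K u" for c x
    using lin that
    by (subst (asm) linear_map_iff[OF line_through_subspace[OF uP(1)] line_through_subspace[OF vP(1)]])
       blast
  have u1: "u = \<one> \<odot>\<^bsub>plane\<^esub> u" using uP by (simp)
  have uu: "u \<in> line_through K u" using line_throughI[OF one_closed, of u] u1 by simp
  have zu: "\<zero>\<^bsub>plane\<^esub> = \<zero> \<odot>\<^bsub>plane\<^esub> u" using uP by (simp)
  have zz: "\<zero>\<^bsub>plane\<^esub> \<in> line_through K u" using line_throughI[OF zero_closed, of u] zu by simp
  have fu: "f u \<in> line_through K v" using bij uu bij_betwE by blast
  then obtain t where t: "t \<in> carrier K" "f u = t \<odot>\<^bsub>plane\<^esub> v" by (meson line_throughE)
  have "f \<zero>\<^bsub>plane\<^esub> = \<zero> \<odot>\<^bsub>plane\<^esub> f u" using smult[OF zero_closed uu] zu by simp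
  also have "\<dots> = \<zero>\<^bsub>plane\<^esub>" using t vP by (simp)
  finally have f0: "f \<zero>\<^bsub>plane\<^esub> = \<zero>\<^bsub>plane\<^esub>" .
  have "t \<noteq> \<zero>"
  proof
    assume "t = \<zero>"
    then have "f u = f \<zero>\<^bsub>plane\<^esub>" using t vP f0 by (simp)
    then show False using bij uu zz uP unfolding bij_betw_def inj_on_def by blast
  qed
  moreover have "f = snd (snd (scaling_arrow K u v t))"
  proof (rule extensionalityI[OF ext])
    show "snd (snd (scaling_arrow K u v t)) \<in> extensional (line_through K u)"
      by (simp add: scaling_arrow_def)
  next
    fix x assume "x \<in> line_through K u"
    then obtain c where c: "c \<in> carrier K" "x = c \<odot>\<^bsub>plane\<^esub> u" by (meson line_throughE)
    have "f x = c \<odot>\<^bsub>plane\<^esub> (t \<odot>\<^bsub>plane\<^esub> v)" using smult[OF c(1) uu] t c by simp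
    also have "\<dots> = (c \<otimes> t) \<odot>\<^bsub>plane\<^esub> v"
      using c t vP by (simp add: P.smult_assoc1)
    finally show "f x = snd (snd (scaling_arrow K u v t)) x"
      using c u by (simp only: scaling_arrow_apply)
  qed
  ultimately show ?thesis
    using t by (intro bexI[of _ t]) (auto simp: hf scaling_arrow_def)
qed

lemma scaling_arrow_inj:
  assumes u: "u \<in> nonzero_vectors K" and v: "v \<in> nonzero_vectors K"
    and st: "s \<in> carrier K" "t \<in> carrier K"
    and eq: "scaling_arrow K u v s = scaling_arrow K u v t"
  shows "s = t"
proof -
  have "(\<one> \<otimes> s) \<odot>\<^bsub>plane\<^esub> v = (\<one> \<otimes> t) \<odot>\<^bsub>plane\<^esub> v"
    using scaling_arrow_apply[OF u one_closed, of v] eq by metis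
  then show ?thesis using st v by (simp add: smult_eq_iff)
qed

lemma scaling_arrow_bij_betw:
  assumes "u \<in> nonzero_vectors K" "v \<in> nonzero_vectors K"
  shows "bij_betw (scaling_arrow K u v) (carrier K - {\<zero>})
    (arrows (plane_groupoid K) (line_through K u) (line_through K v))"
proof (rule bij_betw_imageI)
  show "inj_on (scaling_arrow K u v) (carrier K - {\<zero>})"
    by (rule inj_onI) (blast dest: scaling_arrow_inj[OF assms])
  show "scaling_arrow K u v ` (carrier K - {\<zero>}) =
      arrows (plane_groupoid K) (line_through K u) (line_through K v)"
    using scaling_arrow_in_arrows[OF assms] scaling_arrow_surj[OF assms] by blast
qed

lemma scaling_arrow_comp:
  assumes u: "u \<in> nonzero_vectors K" and v: "v \<in> nonzero_vectors K"
    and w: "w \<in> nonzero_vectors K" and st: "s \<in> carrier K" "t \<in> carrier K"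
  shows "scaling_arrow K u v s \<Zsemi>\<^bsub>plane_groupoid K\<^esub> scaling_arrow K v w t = scaling_arrow K u w (s \<otimes> t)"
proof -
  have "compose (line_through K u) (snd (snd (scaling_arrow K v w t)))
      (snd (snd (scaling_arrow K u v s))) = snd (snd (scaling_arrow K u w (s \<otimes> t)))"
  proof (rule extensionalityI[of _ "line_through K u"])
    fix x assume x: "x \<in> line_through K u"
    then obtain c where c: "c \<in> carrier K" "x = c \<odot>\<^bsub>plane\<^esub> u" by (meson line_throughE)
    have "c \<otimes> s \<otimes> t = c \<otimes> (s \<otimes> t)" using c st by (simp add: m_assoc)
    then show "compose (line_through K u) (snd (snd (scaling_arrow K v w t)))
        (snd (snd (scaling_arrow K u v s))) x = snd (snd (scaling_arrow K u w (s \<otimes> t))) x"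
      unfolding compose_eq[OF x] using c st by (simp only: scaling_arrow_apply u v m_closed)
  qed (simp_all add: scaling_arrow_def)
  then show ?thesis by (simp add: scaling_arrow_def plane_groupoid_def)
qed

lemma scaling_arrow_id:
  assumes u: "u \<in> nonzero_vectors K"
  shows "scaling_arrow K u u \<one> = Idt (plane_groupoid K) (line_through K u)"
proof -
  have "snd (snd (scaling_arrow K u u \<one>)) = restrict id (line_through K u)"
  proof (rule extensionalityI[of _ "line_through K u"])
    fix x assume x: "x \<in> line_through K u"
    then obtain c where c: "c \<in> carrier K" "x = c \<odot>\<^bsub>plane\<^esub> u" by (meson line_throughE)
    have "snd (snd (scaling_arrow K u u \<one>)) x = x"
      using c by (simp only: scaling_arrow_apply u r_one)
    then show "snd (snd (scaling_arrow K u u \<one>)) x = restrict id (line_through K u) x"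
      using x by simp
  qed (simp_all add: scaling_arrow_def)
  then show ?thesis by (simp add: scaling_arrow_def plane_groupoid_def)
qed

lemma bracket_closed [simp]:
  "u \<in> carrier plane \<Longrightarrow> v \<in> carrier plane \<Longrightarrow> bracket K u v \<in> carrier K"
  by (auto simp: bracket_def plane_simps)

lemma plane_minus:
  assumes "a \<in> carrier K" "b \<in> carrier K" "c \<in> carrier K" "d \<in> carrier K"
  shows "(a, b) \<ominus>\<^bsub>plane\<^esub> (c, d) = (a \<ominus> c, b \<ominus> d)"
proof -
  have "\<ominus>\<^bsub>plane\<^esub> (c, d) = (\<ominus> c, \<ominus> d)"
    using assms by (intro P.M.minus_equality) (auto simp: l_neg plane_simps)
  then show ?thesis using assms by (simp add: minus_eq P.M.minus_eq plane_simps)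
qed

lemma bracket_diff:
  assumes "u \<in> carrier plane" "v \<in> carrier plane" "w \<in> carrier plane" "c \<in> carrier K" "d \<in> carrier K"
  shows "bracket K (c \<odot>\<^bsub>plane\<^esub> u \<ominus>\<^bsub>plane\<^esub> d \<odot>\<^bsub>plane\<^esub> v) w =
    c \<otimes> bracket K u w \<ominus> d \<otimes> bracket K v w"
proof -
  obtain u1 u2 v1 v2 w1 w2 where [simp]: "u = (u1, u2)" "v = (v1, v2)" "w = (w1, w2)"
    by (meson surj_pair)
  have [simp]: "u1 \<in> carrier K" "u2 \<in> carrier K" "v1 \<in> carrier K" "v2 \<in> carrier K"
    "w1 \<in> carrier K" "w2 \<in> carrier K" using assms by (auto simp: plane_simps)
  show ?thesis using assms
    by (simp add: plane_minus plane_simps bracket_def minus_eq l_distr r_distr l_minus r_minus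
        minus_add m_ac a_ac)
qed

lemma line_through_iff_bracket:
  assumes x: "x \<in> carrier plane" and w: "w \<in> nonzero_vectors K"
  shows "x \<in> line_through K w \<longleftrightarrow> bracket K x w = \<zero>"
proof -
  obtain x1 x2 w1 w2 where [simp]: "x = (x1, x2)" "w = (w1, w2)" by (meson surj_pair)
  have [simp]: "x1 \<in> carrier K" "x2 \<in> carrier K" "w1 \<in> carrier K" "w2 \<in> carrier K"
    using x nonzero_vectorsD[OF w] by (auto simp: plane_simps)
  have "bracket K x w = \<zero> \<longleftrightarrow> x1 \<otimes> w2 = x2 \<otimes> w1" by (simp add: bracket_def)
  also have "\<dots> \<longleftrightarrow> x \<in> line_through K w"
  proof
    assume "x \<in> line_through K w"
    then obtain c where c: "c \<in> carrier K" "x1 = c \<otimes> w1" "x2 = c \<otimes> w2"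
      by (auto simp: plane_simps elim!: line_throughE)
    then show "x1 \<otimes> w2 = x2 \<otimes> w1" by (simp add: m_ac)
  next
    assume eq: "x1 \<otimes> w2 = x2 \<otimes> w1"
    have inv: "inv a \<in> carrier K" "inv a \<otimes> a = \<one>" if "a \<in> carrier K" "a \<noteq> \<zero>" for a
      using that by (auto simp: field_Units)
    consider "w1 \<noteq> \<zero>" | "w2 \<noteq> \<zero>" using nonzero_vectorsD[OF w] by (auto simp: plane_simps)
    then show "x \<in> line_through K w"
    proof cases
      case 1
      note i = inv[OF _ 1, simplified]
      have "x1 \<otimes> inv w1 \<otimes> w2 = inv w1 \<otimes> (x1 \<otimes> w2)" using i by (simp add: m_ac)
      also have "\<dots> = inv w1 \<otimes> w1 \<otimes> x2" unfolding eq using i(1) by (simp add: m_ac)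
      finally have "x = (x1 \<otimes> inv w1) \<odot>\<^bsub>plane\<^esub> w" using i by (simp add: m_assoc plane_simps)
      then show ?thesis using i by (metis line_throughI m_closed \<open>x1 \<in> carrier K\<close>)
    next
      case 2
      note i = inv[OF _ 2, simplified]
      have "x2 \<otimes> inv w2 \<otimes> w1 = inv w2 \<otimes> (x2 \<otimes> w1)" using i by (simp add: m_ac)
      also have "\<dots> = inv w2 \<otimes> w2 \<otimes> x1" unfolding eq[symmetric] using i(1) by (simp add: m_ac)
      finally have "x = (x2 \<otimes> inv w2) \<odot>\<^bsub>plane\<^esub> w" using i by (simp add: m_assoc plane_simps)
      then show ?thesis using i by (metis line_throughI m_closed \<open>x2 \<in> carrier K\<close>)
    qed
  qed
  finally show ?thesis by simp
qed

text \<open>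
  A point \<open>c u\<close> is projected to the \<open>d v\<close> for which \<open>c u - d v\<close> lies on the line of \<open>w\<close>. Bracketing
  with \<open>w\<close> turns this into \<open>c [u, w] = d [v, w]\<close>, that is \<open>d = c t\<close>.
\<close>

lemma plane_projection:
  assumes u: "u \<in> nonzero_vectors K" and v: "v \<in> nonzero_vectors K" and w: "w \<in> nonzero_vectors K"
    and t: "t \<in> carrier K" and vw: "bracket K v w \<noteq> \<zero>"
    and eq: "t \<otimes> bracket K v w = bracket K u w"
  shows "\<langle>(line_through K w) : (line_through K u) \<rightarrow> (line_through K v)\<rangle>\<^bsub>plane_groupoid K\<^esub>
    = scaling_arrow K u v t"
proof -
  note P = nonzero_vectorsD(1)[OF u] nonzero_vectorsD(1)[OF v] nonzero_vectorsD(1)[OF w]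
  have the: "(THE b. b \<in> line_through K v \<and> a \<ominus>\<^bsub>plane\<^esub> b \<in> line_through K w) =
      snd (snd (scaling_arrow K u v t)) a" if a: "a \<in> line_through K u" for a
  proof -
    obtain c where c: "c \<in> carrier K" "a = c \<odot>\<^bsub>plane\<^esub> u" using a by (meson line_throughE)
    have *: "a \<ominus>\<^bsub>plane\<^esub> d \<odot>\<^bsub>plane\<^esub> v \<in> line_through K w \<longleftrightarrow> d = c \<otimes> t" if d: "d \<in> carrier K" for d
    proof -
      have "a \<ominus>\<^bsub>plane\<^esub> d \<odot>\<^bsub>plane\<^esub> v \<in> carrier plane"
        unfolding c(2) using P c(1) d by (intro P.M.minus_closed P.smult_closed)
      then have "a \<ominus>\<^bsub>plane\<^esub> d \<odot>\<^bsub>plane\<^esub> v \<in> line_through K w \<longleftrightarrow>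
          c \<otimes> bracket K u w \<ominus> d \<otimes> bracket K v w = \<zero>"
        by (simp only: line_through_iff_bracket[OF _ w] c(2) bracket_diff[OF P c(1) d])
      also have "\<dots> \<longleftrightarrow> (c \<otimes> t) \<otimes> bracket K v w = d \<otimes> bracket K v w"
        unfolding eq[symmetric] using P c(1) d t by (simp add: m_assoc)
      also have "\<dots> \<longleftrightarrow> c \<otimes> t = d"
        using P c(1) d t vw by (simp add: m_rcancel)
      finally show ?thesis by blast
    qed
    have "(THE b. b \<in> line_through K v \<and> a \<ominus>\<^bsub>plane\<^esub> b \<in> line_through K w) = (c \<otimes> t) \<odot>\<^bsub>plane\<^esub> v"
    proof (rule the_equality)
      show "(c \<otimes> t) \<odot>\<^bsub>plane\<^esub> v \<in> line_through K v \<and>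
          a \<ominus>\<^bsub>plane\<^esub> (c \<otimes> t) \<odot>\<^bsub>plane\<^esub> v \<in> line_through K w"
        using * c(1) t by (simp add: line_throughI)
    next
      fix b assume b: "b \<in> line_through K v \<and> a \<ominus>\<^bsub>plane\<^esub> b \<in> line_through K w"
      then obtain d where "d \<in> carrier K" "b = d \<odot>\<^bsub>plane\<^esub> v" by (meson line_throughE)
      with b * show "b = (c \<otimes> t) \<odot>\<^bsub>plane\<^esub> v" by metis
    qed
    then show ?thesis by (simp only: c scaling_arrow_apply[OF u])
  qed
  have "snd (snd (scaling_arrow K u v t)) \<in> extensional (line_through K u)"
    by (simp add: scaling_arrow_def)
  then have "(\<lambda>a \<in> line_through K u. THE b. b \<in> line_through K v \<and> a \<ominus>\<^bsub>plane\<^esub> b \<in> line_through K w) =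
      snd (snd (scaling_arrow K u v t))"
    using the by (intro extensionalityI[of _ "line_through K u"]) (simp_all only: restrict_apply' restrict_extensional)
  then show ?thesis by (simp add: plane_groupoid_def scaling_arrow_def)
qed

lemma line_through_eq_if_mem:
  assumes u: "u \<in> nonzero_vectors K" and w: "w \<in> nonzero_vectors K"
    and mem: "u \<in> line_through K w"
  shows "line_through K u = line_through K w"
proof -
  note P = nonzero_vectorsD[OF u] nonzero_vectorsD[OF w]
  obtain c where c: "c \<in> carrier K" "u = c \<odot>\<^bsub>plane\<^esub> w" using mem by (meson line_throughE)
  have "c \<noteq> \<zero>" using P c by auto
  then have i: "inv c \<in> carrier K" "inv c \<otimes> c = \<one>" using c by (auto simp: field_Units)
  have 1: "d \<odot>\<^bsub>plane\<^esub> u = (d \<otimes> c) \<odot>\<^bsub>plane\<^esub> w" if "d \<in> carrier K" for d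
    using that c P by (simp add: P.smult_assoc1)
  have 2: "d \<odot>\<^bsub>plane\<^esub> w = (d \<otimes> inv c) \<odot>\<^bsub>plane\<^esub> u" if "d \<in> carrier K" for d
    using that c(1) i 1[of "d \<otimes> inv c"] by (simp add: m_assoc)
  show ?thesis
  proof
    show "line_through K u \<subseteq> line_through K w"
      using 1 c by (metis line_throughE line_throughI m_closed subsetI)
    show "line_through K w \<subseteq> line_through K u"
      using 2 i by (metis line_throughE line_throughI m_closed subsetI)
  qed
qed

end

section \<open>Coordinates from projection scalars\<close>

text \<open>
  This isolates what the construction of coordinates uses: \<open>q A B C\<close> stands for the scalar of
  \<open>\<langle>C : A \<rightarrow> B\<rangle>\<close> with respect to a frame that makes all the arrows \<open>\<langle>P : A \<rightarrow> B\<rangle>\<close> trivial. The point \<open>P\<close>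
  becomes the point at infinity and \<open>Q\<close> the origin. The assumption \<open>q_swap\<close> says that interchanging
  the two middle points of a cross ratio is \<open>\<lambda> \<mapsto> 1 - \<lambda>\<close>, and \<open>q_triple\<close> that tri-rapports are \<open>-1\<close>.
\<close>

locale projection_scalars = scalar_plane K for K :: "'k ring" (structure) +
  fixes X :: "'o set" and q :: "'o \<Rightarrow> 'o \<Rightarrow> 'o \<Rightarrow> 'k" and Q P :: 'o
  assumes base: "Q \<in> X" "P \<in> X" "Q \<noteq> P"
    and q_bij: "\<lbrakk>A \<in> X; B \<in> X; A \<noteq> B\<rbrakk> \<Longrightarrow> bij_betw (q A B) (X - {A, B}) (carrier K - {\<zero>})"
    and q_inverse: "\<lbrakk>{A, B, C} \<subseteq> X; distinct [A, B, C]\<rbrakk> \<Longrightarrow> q A B C \<otimes> q B A C = \<one>"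
    and q_trans: "\<lbrakk>{A, B, C, D} \<subseteq> X; distinct [A, B, C, D]\<rbrakk>
      \<Longrightarrow> q A B C \<otimes> q B D C = q A D C"
    and q_swap: "\<lbrakk>{A, B, C, D} \<subseteq> X; distinct [A, B, C, D]\<rbrakk>
      \<Longrightarrow> q A C B \<otimes> q C A D = \<one> \<ominus> q A B C \<otimes> q B A D"
    and q_triple: "\<lbrakk>{A, B, C} \<subseteq> X; distinct [A, B, C]\<rbrakk>
      \<Longrightarrow> q A B C \<otimes> q B C A \<otimes> q C A B = \<ominus> \<one>"
    and q_base: "\<lbrakk>{A, B} \<subseteq> X; distinct [A, B, P]\<rbrakk> \<Longrightarrow> q A B P = \<one>"
begin

lemma q_closed:
  assumes "{A, B, C} \<subseteq> X" "distinct [A, B, C]"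
  shows "q A B C \<in> carrier K" "q A B C \<noteq> \<zero>"
  using q_bij[of A B] assms by (auto dest: bij_betwE)

text \<open>
  In the plane, with \<open>(1, 0)\<close> spanning \<open>P\<close> and \<open>(a, 1)\<close> spanning \<open>A\<close>, the projection \<open>\<langle>A : Q \<rightarrow> P\<rangle>\<close> sends
  \<open>(0, 1)\<close> to \<open>(-a, 0)\<close>. Reading the coordinate off this arrow makes it bijective for free, because
  the arrows \<open>Q \<rightarrow> P\<close> correspond to the points \<open>A \<noteq> Q, P\<close>.
\<close>

definition coord :: "'o \<Rightarrow> 'k"
  where "coord A = (if A = Q then \<zero> else \<ominus> q Q P A)"

definition vec :: "'o \<Rightarrow> 'k \<times> 'k"
  where "vec A = (if A = P then (\<one>, \<zero>) else (coord A, \<one>))"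

lemma coord_bij: "bij_betw coord (X - {P}) (carrier K)"
proof -
  have "bij_betw (\<lambda>A. \<ominus> q Q P A) (X - {Q, P}) (carrier K - {\<zero>})"
  proof -
    have "bij_betw (\<lambda>x. \<ominus> x) (carrier K - {\<zero>}) (carrier K - {\<zero>})"
      by (rule bij_betw_byWitness[where f' = "\<lambda>x. \<ominus> x"]) auto
    from bij_betw_trans[OF q_bij[OF base] this] show ?thesis by (simp add: comp_def)
  qed
  then have "bij_betw coord (X - {Q, P}) (carrier K - {\<zero>})"
    by (rule bij_betw_cong[THEN iffD1, rotated]) (simp add: coord_def)
  then have "bij_betw coord (insert Q (X - {Q, P})) (insert \<zero> (carrier K - {\<zero>}))"
    using notIn_Un_bij_betw[of Q "X - {Q, P}" coord "carrier K - {\<zero>}"] by (simp add: coord_def)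
  moreover have "insert Q (X - {Q, P}) = X - {P}" "insert \<zero> (carrier K - {\<zero>}) = carrier K"
    using base by auto
  ultimately show ?thesis by simp
qed

lemma coord_closed: "A \<in> X \<Longrightarrow> A \<noteq> P \<Longrightarrow> coord A \<in> carrier K"
  using coord_bij bij_betwE by fastforce

lemma vec_closed: "A \<in> X \<Longrightarrow> vec A \<in> carrier plane"
  by (simp add: vec_def plane_simps coord_closed)

lemma vec_nonzero: "A \<in> X \<Longrightarrow> vec A \<in> nonzero_vectors K"
  using vec_closed by (auto simp: nonzero_vectors_def vec_def plane_simps)

abbreviation br :: "'o \<Rightarrow> 'o \<Rightarrow> 'k"
  where "br A B \<equiv> bracket K (vec A) (vec B)"

lemma br_simps:
  assumes "A \<in> X" "A \<noteq> P"
  shows "br A P = \<ominus> \<one>" "br P A = \<one>"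
    "\<lbrakk>B \<in> X; B \<noteq> P\<rbrakk> \<Longrightarrow> br A B = coord A \<ominus> coord B"
  using assms coord_closed by (simp_all add: bracket_def vec_def minus_eq)

lemma br_nonzero:
  assumes "A \<in> X" "B \<in> X" "A \<noteq> B"
  shows "br A B \<noteq> \<zero>"
proof -
  consider "A = P" | "B = P" | "A \<noteq> P" "B \<noteq> P" by blast
  then show ?thesis
  proof cases
    case 3
    then have "coord A \<noteq> coord B"
      using coord_bij assms unfolding bij_betw_def inj_on_def by blast
    with 3 show ?thesis using assms coord_closed by (simp add: br_simps)
  qed (use assms br_simps in auto)
qed

text \<open>
  The equation that \<open>q A B C\<close> satisfies if it is the scalar of the projection in the plane from the
  line of \<open>vec A\<close> to the line of \<open>vec B\<close> along the line of \<open>vec C\<close>.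
\<close>

definition coordinatized :: "'o \<Rightarrow> 'o \<Rightarrow> 'o \<Rightarrow> bool"
  where "coordinatized A B C \<longleftrightarrow> q A B C \<otimes> br B C = br A C"

lemma coordinatized_sym:
  assumes "{A, B, C} \<subseteq> X" "distinct [A, B, C]" "coordinatized A B C"
  shows "coordinatized B A C"
proof -
  have c: "q A B C \<in> carrier K" "q B A C \<in> carrier K" "br B C \<in> carrier K"
    using assms q_closed by (auto simp: vec_closed)
  have "q B A C \<otimes> br A C = q B A C \<otimes> (q A B C \<otimes> br B C)"
    using assms(3) by (simp add: coordinatized_def)
  also have "\<dots> = (q A B C \<otimes> q B A C) \<otimes> br B C" using c by (simp add: m_ac)
  finally show ?thesis
    using c assms(1,2) q_inverse by (simp add: coordinatized_def)
qed

lemma coordinatized_trans: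
  assumes "{A, B, C, D} \<subseteq> X" "distinct [A, B, C, D]" "coordinatized A B C" "coordinatized B D C"
  shows "coordinatized A D C"
proof -
  have c: "q A B C \<in> carrier K" "q B D C \<in> carrier K" "br D C \<in> carrier K"
    using assms q_closed by (auto simp: vec_closed)
  have "br A C = q A B C \<otimes> (q B D C \<otimes> br D C)"
    using assms(3,4) by (simp add: coordinatized_def)
  also have "\<dots> = q A D C \<otimes> br D C"
    using c q_trans[OF assms(1,2)] by (simp add: m_assoc[symmetric])
  finally show ?thesis by (simp add: coordinatized_def)
qed

text \<open>
  For fixed \<open>C\<close> the relation is symmetric and transitive in the other two points, so it is enough to
  compare every point with one centre \<open>B\<close>.
\<close>

lemma coordinatized_star:
  assumes star: "\<And>A. A \<in> X \<Longrightarrow> A \<noteq> C \<Longrightarrow> A \<noteq> B \<Longrightarrow> coordinatized A B C"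
    and X: "{A, B, C, D} \<subseteq> X" "distinct [A, D, C]" "B \<noteq> C"
  shows "coordinatized A D C"
proof -
  have B: "coordinatized B D' C" if "D' \<in> X" "D' \<noteq> C" "D' \<noteq> B" for D'
    using that X by (intro coordinatized_sym[OF _ _ star]) auto
  consider "A = B" | "D = B" | "A \<noteq> B" "D \<noteq> B" by blast
  then show ?thesis
  proof cases
    case 3
    then show ?thesis
      using star[of A] B[of D] X by (intro coordinatized_trans[of A B C D]) auto
  qed (use star B X in auto)
qed

lemma coordinatized_at_P:
  assumes "{A, B} \<subseteq> X" "distinct [A, B, P]"
  shows "coordinatized A B P"
  using assms q_base by (simp add: coordinatized_def br_simps)

text \<open>
  Since \<open>q Q A P = 1\<close>, the tri-rapport of \<open>A\<close>, \<open>P\<close>, \<open>Q\<close> gives \<open>q A P Q = - q Q P A\<close>, the coordinate of \<open>A\<close>.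
\<close>

lemma coordinatized_at_Q:
  assumes "A \<in> X" "A \<noteq> Q" "A \<noteq> P"
  shows "coordinatized A P Q"
proof -
  have c: "q Q P A \<in> carrier K" "q A P Q \<in> carrier K" "q P Q A \<in> carrier K" "q Q A P = \<one>"
    using assms base q_closed q_base by auto
  have "q A P Q \<otimes> q P Q A \<otimes> q Q A P = \<ominus> \<one>"
    using assms base by (intro q_triple) auto
  then have "q A P Q \<otimes> q P Q A = \<ominus> \<one>" using c by simp
  then have "(q A P Q \<otimes> q P Q A) \<otimes> q Q P A = \<ominus> q Q P A" using c by (simp add: l_minus)
  moreover have "(q A P Q \<otimes> q P Q A) \<otimes> q Q P A = q A P Q \<otimes> (q Q P A \<otimes> q P Q A)"
    using c by (simp add: m_ac)
  moreover have "q Q P A \<otimes> q P Q A = \<one>"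
    using assms base by (intro q_inverse) auto
  ultimately have "q A P Q = coord A" using c assms by (simp add: coord_def)
  then show ?thesis
    using assms base coord_closed[of A] by (simp add: coordinatized_def br_simps coord_def minus_eq)
qed

text \<open>
  By the choice of coordinates the equation holds for \<open>Q\<close> and \<open>P\<close>. For the other points \<open>A\<close>, with
  coordinates \<open>a\<close> and \<open>c\<close> of \<open>A\<close> and \<open>C\<close>, the case of the origin gives \<open>q A C Q = a / c\<close>, and \<open>q_swap\<close>
  gives \<open>q A Q C = 1 - q A C Q = (a - c) / (0 - c)\<close>.
\<close>

lemma coordinatized_off_base:
  assumes "{A, C} \<subseteq> X" "distinct [A, C, Q]" "C \<noteq> P"
  shows "coordinatized A Q C"
proof -
  have QP: "coordinatized Q P C"
  proof -
    have "q Q P C \<in> carrier K" using assms base by (intro q_closed) auto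
    moreover have "coord C = \<ominus> q Q P C" "coord Q = \<zero>" using assms by (auto simp: coord_def)
    ultimately show ?thesis
      using assms base by (simp add: coordinatized_def br_simps minus_eq)
  qed
  show ?thesis
  proof (cases "A = P")
    case True
    then show ?thesis using coordinatized_sym[OF _ _ QP] assms base by auto
  next
    case False
    have c: "coord A \<in> carrier K" "coord C \<in> carrier K" "q A C Q \<in> carrier K" "q A Q C \<in> carrier K"
      using assms base False coord_closed q_closed by auto
    have "coordinatized A C Q"
      using assms base False coordinatized_at_Q
      by (intro coordinatized_star[of Q P A C]) auto
    then have 1: "q A C Q \<otimes> coord C = coord A"
      using assms base False c by (simp add: coordinatized_def br_simps coord_def minus_eq)
    have "q A Q C \<otimes> q Q A P = \<one> \<ominus> q A C Q \<otimes> q C A P"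
      using assms base False by (intro q_swap) auto
    then have "q A Q C = \<one> \<ominus> q A C Q"
      using assms base False c q_base by auto
    then have "q A Q C \<otimes> \<ominus> coord C = q A C Q \<otimes> coord C \<ominus> coord C"
      using c by (simp add: minus_eq l_distr l_minus r_minus minus_add a_comm)
    then show ?thesis
      using assms base False c 1 by (simp add: coordinatized_def br_simps) (simp add: coord_def minus_eq)
  qed
qed

text \<open>
  The centre of the star is \<open>P\<close> when \<open>C\<close> is the origin and \<open>Q\<close> when \<open>C\<close> is any other point of the
  affine line; at infinity both sides are read off from \<open>q_base\<close>.
\<close>

lemma scalar_bracket:
  assumes "{A, B, C} \<subseteq> X" "distinct [A, B, C]"
  shows "q A B C \<otimes> br B C = br A C"
proof -
  consider "C = P" | "C = Q" | "C \<noteq> P" "C \<noteq> Q" by blast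
  then have "coordinatized A B C"
  proof cases
    case 1
    then show ?thesis using assms coordinatized_at_P by auto
  next
    case 2
    then show ?thesis using assms base coordinatized_at_Q
      by (intro coordinatized_star[of C P A B]) auto
  next
    case 3
    then show ?thesis using assms base coordinatized_off_base
      by (intro coordinatized_star[of C Q A B]) auto
  qed
  then show ?thesis by (simp add: coordinatized_def)
qed

text \<open>
  A vector \<open>(x, y)\<close> with \<open>y \<noteq> 0\<close> is proportional to the vector of the point with coordinate \<open>x / y\<close>,
  and one with \<open>y = 0\<close> to that of \<open>P\<close>.
\<close>

lemma line_through_vec_bij: "bij_betw (\<lambda>A. line_through K (vec A)) X (plane_lines K)"
proof (rule bij_betw_imageI)
  show "inj_on (\<lambda>A. line_through K (vec A)) X"
  proof (rule inj_onI, rule ccontr)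
    fix A B assume AB: "A \<in> X" "B \<in> X" "line_through K (vec A) = line_through K (vec B)" "A \<noteq> B"
    have "\<one> \<odot>\<^bsub>plane\<^esub> vec A \<in> line_through K (vec A)" by (rule line_throughI) simp
    then have "vec A \<in> line_through K (vec B)" using AB vec_closed by simp
    then show False
      using AB line_through_iff_bracket[OF vec_closed vec_nonzero] br_nonzero by blast
  qed
next
  have "\<exists>A \<in> X. line_through K u = line_through K (vec A)" if u: "u \<in> nonzero_vectors K" for u
  proof -
    have "\<exists>A \<in> X. bracket K u (vec A) = \<zero>"
    proof -
      obtain x y where xy: "u = (x, y)" "x \<in> carrier K" "y \<in> carrier K"
        using nonzero_vectorsD(1)[OF u] by (auto simp: plane_simps)
      show ?thesis
      proof (cases "y = \<zero>")
        case True
        then show ?thesis using xy base by (intro bexI[of _ P]) (simp_all add: bracket_def vec_def minus_eq)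
      next
        case False
        then have i: "inv y \<in> carrier K" "y \<otimes> inv y = \<one>" using xy by (auto simp: field_Units)
        then have "x \<otimes> inv y \<in> coord ` (X - {P})"
          using coord_bij xy unfolding bij_betw_def by auto
        then obtain A where A: "A \<in> X" "A \<noteq> P" "coord A = x \<otimes> inv y" by (metis imageE DiffE singletonI)
        have "y \<otimes> coord A = x \<otimes> (y \<otimes> inv y)" unfolding A using xy i(1) by (simp add: m_ac)
        then show ?thesis using A xy i by (intro bexI[of _ A]) (simp_all add: bracket_def vec_def)
      qed
    qed
    then obtain A where A: "A \<in> X" "bracket K u (vec A) = \<zero>" by blast
    then have "u \<in> line_through K (vec A)"
      using line_through_iff_bracket nonzero_vectorsD[OF u] vec_nonzero by blast
    then show ?thesis using line_through_eq_if_mem[OF u vec_nonzero] A by blast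
  qed
  then show "(\<lambda>A. line_through K (vec A)) ` X = plane_lines K"
    using vec_nonzero unfolding plane_lines_eq by blast
qed

end

section \<open>The isomorphism\<close>

theorem theorem5p2:
  fixes L :: "('o, 'a) pgpd"
  assumes "projective_line_groupoid L"
    and "\<exists>S \<subseteq> Obj L. card S = 5"
  shows "isomorphic_proj_groupoids L (plane_groupoid (scalar_field L))"
proof -
  interpret projective_line_groupoid L by fact
  obtain S where S: "S \<subseteq> Obj L" "card S = 5" using assms(2) by blast
  obtain Q where Q: "Q \<in> Obj L" by (rule some_point)
  obtain P where P: "P \<in> Obj L" "P \<noteq> Q" using extra_point[OF Q Q] by metis
  obtain \<tau> where \<tau>: "\<tau> \<in> arrows L Q P" using Q P(1) by (rule connected)
  \<comment> \<open>The frame makes every \<open>\<langle>P : A \<rightarrow> B\<rangle>\<close> trivial by Axiom 1; the arrow \<open>Q \<rightarrow> P\<close> only fixes a scale.\<close>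
  define \<gamma> where "\<gamma> A = (if A = Q then Idt L Q else if A = P then \<tau> else \<langle>P : Q \<rightarrow> A\<rangle>\<^bsub>L\<^esub>)" for A
  interpret framed_projective_line_four_points L Q \<gamma>
  proof
    show "Q \<in> Obj L" by fact
    show "\<gamma> A \<in> arrows L Q A" if "A \<in> Obj L" for A
      using that Q P \<tau> id_closed[OF Q] proj_arrow[of Q A P] by (simp add: \<gamma>_def)
    show "\<exists>D \<in> Obj L. D \<notin> {A, B, C}" for A B C
    proof -
      have "card {A, B, C} \<le> 3" by (simp add: card_insert_if)
      then have "\<not> S \<subseteq> {A, B, C}" using S(2) card_mono[of "{A, B, C}" S] by auto
      then show ?thesis using S(1) by blast
    qed
  qed
  have base: "proj_scalar A B P = \<one>\<^bsub>G\<^esub>" if X: "{A, B} \<subseteq> Obj L" "distinct [A, B, P]" for A B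
  proof -
    have a: "\<langle>P : A \<rightarrow> B\<rangle>\<^bsub>L\<^esub> \<in> arrows L A B" using X P by (intro proj_arrow) auto
    have B: "B \<in> Obj L" using X by simp
    have "\<gamma> A \<Zsemi>\<^bsub>L\<^esub> \<langle>P : A \<rightarrow> B\<rangle>\<^bsub>L\<^esub> = \<gamma> B"
    proof -
      consider "A = Q" | "B = Q" | "A \<noteq> Q" "B \<noteq> Q" by blast
      then show ?thesis
      proof cases
        case 1
        then show ?thesis using X id_left[OF a] by (auto simp: \<gamma>_def)
      next
        case 2
        then show ?thesis using X P axiom1_inverse[of Q A P] by (auto simp: \<gamma>_def)
      next
        case 3
        then show ?thesis using X P Q axiom1_trans[of Q A P B] by (auto simp: \<gamma>_def)
      qed
    qed
    then show ?thesis
      using inverse_arrow(2)[OF frame[OF B]] scalar_id[OF Q] by (simp add: proj_scalar_def arrow_scalar_eq[OF a])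
  qed
  interpret C: projection_scalars K "Obj L" "\<lambda>A B C. Some (proj_scalar A B C)" Q P
  proof (intro projection_scalars.intro scalar_plane.intro projection_scalars_axioms.intro)
    show "field K" by (rule scalars_field)
    show "Q \<in> Obj L" "P \<in> Obj L" "Q \<noteq> P" using Q P by auto
  next
    fix A B assume AB: "A \<in> Obj L" "B \<in> Obj L" "A \<noteq> B"
    have "bij_betw Some (carrier G) (carrier K - {\<zero>\<^bsub>K\<^esub>})"
      by (simp add: K_simps(1) bij_betw_def)
    from bij_betw_trans[OF proj_scalar_bij[OF AB] this]
    show "bij_betw (\<lambda>C. Some (proj_scalar A B C)) (Obj L - {A, B}) (carrier K - {\<zero>\<^bsub>K\<^esub>})"
      by (simp add: comp_def)
  next
    fix A B C assume X: "{A, B, C} \<subseteq> Obj L" "distinct [A, B, C]"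
    show "Some (proj_scalar A B C) \<otimes>\<^bsub>K\<^esub> Some (proj_scalar B A C) = \<one>\<^bsub>K\<^esub>"
      by (simp add: K_simps proj_scalar_inverse[OF X])
    show "Some (proj_scalar A B C) \<otimes>\<^bsub>K\<^esub> Some (proj_scalar B C A) \<otimes>\<^bsub>K\<^esub> Some (proj_scalar C A B) = \<ominus>\<^bsub>K\<^esub> \<one>\<^bsub>K\<^esub>"
      using scalar_minus_one_eq[OF X] K_minus_one by (simp add: K_simps(4) triple_def)
  next
    fix A B C D assume X: "{A, B, C, D} \<subseteq> Obj L" "distinct [A, B, C, D]"
    show "Some (proj_scalar A B C) \<otimes>\<^bsub>K\<^esub> Some (proj_scalar B D C) = Some (proj_scalar A D C)"
      by (simp add: K_simps proj_scalar_trans[OF X])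
    have Y: "{A, C, B, D} \<subseteq> Obj L" "distinct [A, C, B, D]" using X by auto
    show "Some (proj_scalar A C B) \<otimes>\<^bsub>K\<^esub> Some (proj_scalar C A D) = \<one>\<^bsub>K\<^esub> \<ominus>\<^bsub>K\<^esub> Some (proj_scalar A B C) \<otimes>\<^bsub>K\<^esub> Some (proj_scalar B A D)"
      using K_involution[OF X] scalar_cross_ratio[OF X] scalar_cross_ratio[OF Y] by (simp add: K_simps(4))
  next
    fix A B assume "{A, B} \<subseteq> Obj L" "distinct [A, B, P]"
    then show "Some (proj_scalar A B P) = \<one>\<^bsub>K\<^esub>" by (simp add: base K_simps(3))
  qed
  \<comment> \<open>The isomorphism sends \<open>A\<close> to the line of its vector and \<open>f : A \<rightarrow> B\<close> to multiplication by its scalar.\<close>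
  define Fo where "Fo A = line_through K (C.vec A)" for A
  define Fa where "Fa f = scaling_arrow K (C.vec (Dom L f)) (C.vec (Cod L f)) (Some (arrow_scalar f))" for f
  have Fa: "Fa f = scaling_arrow K (C.vec A) (C.vec B) (Some (arrow_scalar f))" if "f \<in> arrows L A B" for f A B
    using arrowsD[OF that] by (simp add: Fa_def)
  have arrow_scalar_in_K: "Some (arrow_scalar f) \<in> carrier K" if "f \<in> arrows L A B" for f A B
    using K_simps(1) arrow_scalar_closed[OF that] by blast
  have vec: "C.vec A \<in> nonzero_vectors K" if "f \<in> arrows L A B \<or> f \<in> arrows L B A" for f A B
    using that arrowsD(4,5) C.vec_nonzero by blast
  interpret proj_groupoid_bijection L "plane_groupoid K" Fo Fa
  proof (rule proj_groupoid_bijection.intro[OF proj_groupoid_axioms],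
      rule proj_groupoid_bijection_axioms.intro)
    show "bij_betw Fo (Obj L) (Obj (plane_groupoid K))"
      using C.line_through_vec_bij by (simp add: Fo_def[abs_def] plane_groupoid_def)
  next
    fix A B assume AB: "A \<in> Obj L" "B \<in> Obj L"
    have "bij_betw (Some \<circ> arrow_scalar) (arrows L A B) (carrier K - {\<zero>\<^bsub>K\<^esub>})"
      by (rule bij_betw_trans[OF arrow_scalar_bij[OF AB]]) (simp add: K_simps(1) bij_betw_def)
    from bij_betw_trans[OF this C.scaling_arrow_bij_betw[OF C.vec_nonzero[OF AB(1)] C.vec_nonzero[OF AB(2)]]]
    show "bij_betw Fa (arrows L A B) (arrows (plane_groupoid K) (Fo A) (Fo B))"
      unfolding Fo_def by (rule bij_betw_cong[THEN iffD1, rotated]) (simp add: Fa)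
  next
    fix f' assume "f' \<in> Arr (plane_groupoid K)"
    then show "Dom (plane_groupoid K) f' \<in> Obj (plane_groupoid K) \<and>
        Cod (plane_groupoid K) f' \<in> Obj (plane_groupoid K)"
      by (auto simp: plane_groupoid_def)
  next
    fix A assume A: "A \<in> Obj L"
    show "Fa (Idt L A) = Idt (plane_groupoid K) (Fo A)"
      using C.scaling_arrow_id[OF C.vec_nonzero[OF A]]
      by (simp add: Fa[OF id_closed[OF A]] arrow_scalar_id[OF A] K_simps(3) Fo_def)
  next
    fix f A B g C assume f: "f \<in> arrows L A B" and g: "g \<in> arrows L B C"
    have "Fa (f \<Zsemi>\<^bsub>L\<^esub> g) = scaling_arrow K (C.vec A) (C.vec C) (Some (arrow_scalar f) \<otimes>\<^bsub>K\<^esub> Some (arrow_scalar g))"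
      by (simp add: Fa[OF comp_closed[OF f g]] arrow_scalar_comp[OF f g] K_simps(4))
    also have "\<dots> = Fa f \<Zsemi>\<^bsub>plane_groupoid K\<^esub> Fa g"
      unfolding Fa[OF f] Fa[OF g]
      using arrowsD(4,5)[OF f] arrowsD(5)[OF g]
      by (intro C.scaling_arrow_comp[symmetric] C.vec_nonzero arrow_scalar_in_K[OF f] arrow_scalar_in_K[OF g])
    finally show "Fa (f \<Zsemi>\<^bsub>L\<^esub> g) = Fa f \<Zsemi>\<^bsub>plane_groupoid K\<^esub> Fa g" .
  next
    fix A B C assume X: "{A, B, C} \<subseteq> Obj L" "distinct [A, B, C]"
    have "Fa \<langle>C : A \<rightarrow> B\<rangle>\<^bsub>L\<^esub> = scaling_arrow K (C.vec A) (C.vec B) (Some (proj_scalar A B C))"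
      by (simp add: Fa[OF proj_arrow[OF X]] proj_scalar_def)
    also have "\<dots> = \<langle>(Fo C) : (Fo A) \<rightarrow> (Fo B)\<rangle>\<^bsub>plane_groupoid K\<^esub>"
      unfolding Fo_def
      using X C.vec_nonzero C.br_nonzero[of B C] C.q_closed[OF X] C.scalar_bracket[OF X]
      by (intro C.plane_projection[symmetric]) auto
    finally show "Fa \<langle>C : A \<rightarrow> B\<rangle>\<^bsub>L\<^esub> = \<langle>(Fo C) : (Fo A) \<rightarrow> (Fo B)\<rangle>\<^bsub>plane_groupoid K\<^esub>" .
  qed
  show ?thesis unfolding isomorphic_proj_groupoids_def using isomorphism by blast
qed

end
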